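(* Let $q$ be a power of $2$ and let $f(X)=X+aX^{q(q-1)+1}+bX^{2(q-1)+1}\in\mathbb{F}_{q^2}[X]$, where $a\in\mathbb{F}_{q^2}^*$ and $b\in\mathbb{F}_q^*$. Then $f$ is a permutation polynomial of $\mathbb{F}_{q^2}$ (i.e., the map $x\mapsto f(x)$ is a bijection of $\mathbb{F}_{q^2}$) if and only if one of the following holds: (i) $b=1$, $a\in\mathbb{F}_q^*$ and $\mathrm{Tr}_{q/2}(1+a^{-1})=0$; or (ii) $b\ne 1$, $\mathrm{Tr}_{q/2}\bigl(b/(b+1)\bigr)=0$ and $a^2=b(b+1)$.
   Context: $\mathbb{F}_q$ denotes the finite field with $q$ elements, and $\mathrm{Tr}_{q/2}:\mathbb{F}_q\to\mathbb{F}_2$ is the absolute trace map $x\mapsto x+x^2+x^{2^2}+\cdots+x^{q/2}$. *)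

theory Defs
  imports
    "HOL-Library.Cardinality"
    "HOL-Computational_Algebra.Computational_Algebra"
    "HOL-Algebra.Algebraic_Closure_Type"
begin

definition permutation_polynomial :: "'a :: finite_field poly \<Rightarrow> bool" where
  "permutation_polynomial f \<longleftrightarrow> bij (\<lambda>x. poly f x)"

text \<open>
  The absolute trace of the field with \<open>q = 2 ^ n\<close> elements,
  \<open>x + x\<^sup>2 + x ^ (2 ^ 2) + \<dots> + x ^ (q div 2)\<close>. It is meant for elements of the subfield of
  order \<open>2 ^ n\<close> of \<open>'a\<close>; its values then lie in the prime field \<open>{0, 1}\<close>.
\<close>

definition absolute_trace :: "nat \<Rightarrow> 'a :: finite_field \<Rightarrow> 'a" where
  "absolute_trace n x = (\<Sum>i<n. x ^ (2 ^ i))"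

definition trinomial :: "nat \<Rightarrow> 'a \<Rightarrow> 'a \<Rightarrow> 'a :: finite_field poly" where
  "trinomial q a b =
     Polynomial.monom 1 1
     + Polynomial.monom a (q * (q - 1) + 1)
     + Polynomial.monom b (2 * (q - 1) + 1)"

end

theory Submission
  imports Defs "HOL-Number_Theory.Residues"
begin

text \<open>
  Write \<open>cj x = x ^ q\<close>, let \<open>K\<close> be the fixed field of \<open>cj\<close> and \<open>U\<close> the group of norm-one
  elements. In characteristic 2 every nonzero \<open>x\<close> is uniquely \<open>c * m\<close> with \<open>c \<in> K\<close>,
  \<open>m \<in> U\<close>, and the trinomial sends \<open>c * m\<close> to \<open>c * (m + a * m ^ 3 + b * cj m ^ 3)\<close>. So it permutes
  the field iff for each direction \<open>w \<in> U\<close> a certain cubic form, self-conjugate under \<open>cj\<close>, has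
  exactly one zero on \<open>U\<close>. By the Artin-Schreier theory of its quadratic cofactor this means, with
  \<open>u = w\<^sup>2\<close>, \<open>P = a + b * u + cj u\<close> and
  \<open>D = 1 + a * cj a + b\<^sup>2 + b * (a * cj u + cj a * u)\<close>, that either \<open>D = P = 0\<close>, or \<open>D \<noteq> 0\<close> and the
  trace of \<open>P * cj P / D\<^sup>2 + 1\<close> vanishes.

  Sufficiency: in both cases \<open>P * cj P / D\<^sup>2\<close> is, up to a constant, of the form \<open>y\<^sup>2 + y\<close>.
  Necessity needs no bound of Hasse-Weil type: the trace condition, transported by a Moebius map that
  sends the two roots of \<open>D\<close> to \<open>0\<close> and \<open>\<infinity>\<close>, says that \<open>\<kappa> * t + cj (\<kappa> * t) + c\<close> has
  trace zero for all \<open>t \<in> U\<close>. This is a polynomial condition of degree at most \<open>q\<close> with \<open>q + 1\<close>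
  solutions, so \<open>\<kappa> = 0\<close>, an algebraic equation that leaves only the two families.
\<close>

section \<open>Finite multiplicative sets and root counting\<close>

text \<open>Multiplication by \<open>x\<close> permutes \<open>S - {0}\<close>; comparing the
  product of all its elements before and after gives Fermat's identity.\<close>

lemma card_power_eq_subset:
  fixes x :: "'a::finite_field"
  assumes "finite S" "x \<in> S" "x \<noteq> 0" "0 \<in> S" "\<And>u v. u \<in> S \<Longrightarrow> v \<in> S \<Longrightarrow> u * v \<in> S"
  shows "x ^ card S = x"
proof -
  let ?S = "S - {0}"
  have inj: "inj_on ((*) x) ?S" using assms(3) by (auto simp: inj_on_def)
  have "(*) x ` ?S = ?S"
    by (rule endo_inj_surj) (use assms inj in auto)
  then have "prod id ?S = (\<Prod>y\<in>?S. x * y)"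
    using prod.reindex[OF inj, of id] by (simp add: comp_def)
  also have "\<dots> = x ^ card ?S * prod id ?S" by (simp add: prod.distrib)
  finally have "x ^ card ?S = 1" using assms(1) by simp
  moreover have "card S = Suc (card ?S)"
    using card_Suc_Diff1[of S 0] assms(1,4) by simp
  ultimately show ?thesis by simp
qed

lemma card_roots_le:
  fixes p :: "'a::idom poly"
  assumes "p \<noteq> 0" "\<And>x. x \<in> S \<Longrightarrow> poly p x = 0"
  shows "card S \<le> degree p"
proof -
  have "card S \<le> card {x. poly p x = 0}"
    by (rule card_mono) (use assms poly_roots_finite in auto)
  also have "\<dots> \<le> degree p" by (rule card_poly_roots_bound) (rule assms(1))
  finally show ?thesis .
qed

section \<open>Arithmetic of characteristic 2 in the field of order \<open>q ^ 2\<close>\<close>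

locale char2_quadratic_ext =
  fixes ty :: "'a :: finite_field itself" and n q :: nat
  assumes n_pos: "n \<ge> 1" and q_eq: "q = 2 ^ n" and card_UNIV_eq: "CARD('a) = q ^ 2"
begin

lemma CHAR_eq_2: "CHAR('a) = 2"
proof -
  have "prime CHAR('a)" by (rule prime_CHAR_semidom) simp
  moreover have "CHAR('a) dvd 2 ^ (n * 2)"
    using CHAR_dvd_CARD[where 'a='a] by (simp add: card_UNIV_eq q_eq power_mult)
  ultimately have "CHAR('a) dvd 2"
    using prime_dvd_power by blast
  with \<open>prime CHAR('a)\<close> show ?thesis
    by (simp add: primes_dvd_imp_eq)
qed

lemma two_eq_0: "(2::'a) = 0"
  using of_nat_CHAR[where 'a='a] by (simp add: CHAR_eq_2)

lemma add_self [simp]: "x + x = (0::'a)"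
  using two_eq_0 by (metis mult_2 mult_zero_left)

lemma add_self_left [simp]: "x + (x + y) = (y::'a)"
  by (simp flip: add.assoc)

lemma minus_eq_plus: "x - y = x + (y::'a)"
  by (metis add_self_left add_diff_cancel_left' add.commute)

lemma add_eq_0: "x + y = 0 \<longleftrightarrow> x = (y::'a)"
  by (metis add_self add_self_left add.right_neutral)

lemma power_two_power_add: "(x + y :: 'a) ^ (2 ^ k) = x ^ (2 ^ k) + y ^ (2 ^ k)"
  using freshmans_dream'[where 'a='a, of "2 ^ k" k x y] CHAR_eq_2 by simp

lemma square_add: "(x + y :: 'a)\<^sup>2 = x\<^sup>2 + y\<^sup>2"
  using power_two_power_add[of x y 1] by simp

lemma square_inj: "x\<^sup>2 = y\<^sup>2 \<longleftrightarrow> x = (y::'a)"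
  by (metis add_eq_0 square_add zero_eq_power2)

lemma q_ge_2: "q \<ge> 2"
  using power_increasing[OF n_pos, of "2::nat"] by (simp add: q_eq)

lemma power_q_add: "(x + y :: 'a) ^ q = x ^ q + y ^ q"
  unfolding q_eq by (rule power_two_power_add)

text \<open>Raising to the power \<open>2 ^ (2 * n - 1)\<close> inverts squaring, because
  \<open>x ^ (q ^ 2) = x\<close>.\<close>

lemma ex_sqrt: "\<exists>y::'a. y\<^sup>2 = x"
proof (rule exI)
  have "q ^ 2 = 2 ^ Suc (2 * n - 1)"
    using n_pos by (simp add: q_eq mult.commute flip: power_mult)
  then have "(x ^ (2 ^ (2 * n - 1)))\<^sup>2 = x ^ (q ^ 2)"
    by (simp add: mult.commute flip: power_mult)
  then show "(x ^ (2 ^ (2 * n - 1)))\<^sup>2 = x"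
    using finite_field_power_card_eq_same[of x] by (simp add: card_UNIV_eq)
qed

section \<open>Conjugation, its fixed field and the unit circle\<close>

definition cj :: "'a \<Rightarrow> 'a" where "cj x = x ^ q"

lemma cj_0 [simp]: "cj 0 = 0" and cj_1 [simp]: "cj 1 = 1"
  using q_ge_2 by (simp_all add: cj_def)

lemma cj_add [simp]: "cj (x + y) = cj x + cj y"
  by (simp add: cj_def power_q_add)

lemma cj_mult [simp]: "cj (x * y) = cj x * cj y"
  by (simp add: cj_def power_mult_distrib)

lemma cj_divide [simp]: "cj (x / y) = cj x / cj y"
  by (simp add: cj_def power_divide)

lemma cj_inverse [simp]: "cj (inverse x) = inverse (cj x)"
  by (simp add: cj_def power_inverse)

lemma cj_power [simp]: "cj (x ^ k) = cj x ^ k"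
  by (simp add: cj_def flip: power_mult) (simp add: mult.commute)

lemma cj_cj [simp]: "cj (cj x) = x"
  using finite_field_power_card_eq_same[of x]
  by (simp add: cj_def card_UNIV_eq power2_eq_square flip: power_mult)

lemma cj_eq_0_iff [simp]: "cj x = 0 \<longleftrightarrow> x = 0"
  by (metis cj_0 cj_cj)

definition K :: "'a set" where "K = {x. cj x = x}"
definition U :: "'a set" where "U = {x. x * cj x = 1}"

lemma K_D: "x \<in> K \<Longrightarrow> cj x = x" by (simp add: K_def)

lemma U_nonzero: "x \<in> U \<Longrightarrow> x \<noteq> 0" by (auto simp: U_def)

lemma U_cj: "x \<in> U \<Longrightarrow> cj x = inverse x"
  unfolding U_def by (simp add: inverse_unique)

lemma U_I: "x \<noteq> 0 \<Longrightarrow> cj x = inverse x \<Longrightarrow> x \<in> U"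
  by (simp add: U_def)

lemma one_in_U [simp]: "1 \<in> U" by (simp add: U_def)

lemma card_K_le: "card K \<le> q"
proof -
  let ?p = "Polynomial.monom 1 q - Polynomial.monom 1 1 :: 'a poly"
  have "q > 1" using q_ge_2 by simp
  then have "coeff ?p q = 1" by simp
  then have "?p \<noteq> 0" by (metis coeff_0 zero_neq_one)
  then have "card K \<le> degree ?p"
    by (rule card_roots_le) (auto simp: K_def cj_def poly_monom)
  also have "\<dots> \<le> q" using \<open>q > 1\<close>
    by (intro degree_diff_le) (auto simp: degree_monom_eq)
  finally show ?thesis .
qed

text \<open>By \<open>card_power_eq_subset\<close> every element of \<open>F\<close> is fixed by
  \<open>cj\<close>, and \<open>K\<close> has at most \<open>q\<close> elements.\<close>

lemma subfield_eq_K: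
  assumes "subfield F (ring_of_type_algebra :: 'a ring)" "card F = q"
  shows "F = K"
proof -
  have sub: "subdomain F (ring_of_type_algebra :: 'a ring)"
    using assms(1) by (rule subfield.axioms)
  have "F \<subseteq> K"
  proof
    fix x assume "x \<in> F"
    have "0 \<in> F" "\<And>u v. u \<in> F \<Longrightarrow> v \<in> F \<Longrightarrow> u * v \<in> F"
      using subdomainE(2,6)[OF sub] by (auto simp: ring_of_type_algebra_def)
    then have "x ^ card F = x"
      using card_power_eq_subset[of F x] \<open>x \<in> F\<close> n_pos by (cases "x = 0") (auto simp: assms(2) q_eq)
    then show "x \<in> K" by (simp add: K_def cj_def assms(2))
  qed
  then show ?thesis
    by (rule card_subset_eq[rotated]) (use assms(2) card_K_le card_mono[OF _ \<open>F \<subseteq> K\<close>] in auto)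
qed

text \<open>\<open>c\<close> is the square root of the norm \<open>x * cj x\<close>; it lies in
  \<open>K\<close> because the norm does and squaring is injective.\<close>

lemma polar:
  assumes "x \<noteq> 0"
  obtains c m where "c \<in> K" "c \<noteq> 0" "m \<in> U" "x = c * m"
proof -
  obtain c where c: "c\<^sup>2 = x * cj x" using ex_sqrt by blast
  have "(cj c)\<^sup>2 = c\<^sup>2" using arg_cong[OF c, of cj] by (simp add: mult.commute) (simp add: c mult.commute)
  then have "c \<in> K" by (simp add: square_inj K_def)
  moreover have "c \<noteq> 0" using c assms by auto
  moreover have "x / c \<in> U"
    using \<open>c \<in> K\<close> \<open>c \<noteq> 0\<close> assms by (simp add: U_def K_def power2_eq_square flip: c)
  ultimately show ?thesis using that[of c "x / c"] by simp
qed

lemma card_polar: "q\<^sup>2 - 1 \<le> (card K - 1) * card U"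
proof -
  have "UNIV - {0} \<subseteq> (\<lambda>(c, m). c * m) ` ((K - {0}) \<times> U)"
  proof
    fix x :: 'a assume "x \<in> UNIV - {0}"
    then obtain c m where "c \<in> K" "c \<noteq> 0" "m \<in> U" "x = c * m" by (auto intro: polar[of x])
    then show "x \<in> (\<lambda>(c, m). c * m) ` ((K - {0}) \<times> U)" by force
  qed
  then have "card (UNIV - {0::'a}) \<le> card ((K - {0}) \<times> U)"
    by (meson card_image_le card_mono finite finite_imageI order_trans)
  also have "\<dots> = (card K - 1) * card U"
    using card_Diff_singleton[of 0 K] by (simp add: card_cartesian_product K_def)
  finally show ?thesis by (simp add: card_UNIV_eq)
qed

text \<open>Counting polar decompositions against \<open>card K \<le> q\<close> gives this bound, on
  which the degree comparison in \<open>tr_linear_on_U\<close> rests.\<close>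

lemma card_U_ge: "card U \<ge> q + 1"
proof -
  have "(q - 1) * (q + 1) = q\<^sup>2 - 1"
    using q_ge_2 by (simp add: algebra_simps power2_eq_square)
  also have "\<dots> \<le> (q - 1) * card U"
    using card_polar card_K_le by (meson diff_le_mono mult_le_mono1 order_trans)
  finally show ?thesis by (simp only: mult_le_cancel1) (use q_ge_2 in linarith)
qed

lemma ex_notin_K: obtains g where "g \<notin> K"
proof -
  have "card K < CARD('a)"
    using card_K_le q_ge_2 by (auto simp: card_UNIV_eq power2_eq_square intro: le_less_trans)
  then have "K \<noteq> UNIV" by auto
  then show ?thesis using that by auto
qed

definition tr :: "'a \<Rightarrow> 'a" where "tr = absolute_trace n"

lemma tr_add: "tr (x + y) = tr x + tr y"
  by (simp add: tr_def absolute_trace_def power_two_power_add sum.distrib)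

text \<open>The sum telescopes for every \<open>x\<close>, inside \<open>K\<close> or not; hence the
  trace detects whether an Artin-Schreier root lies in \<open>K\<close>.\<close>

lemma tr_square_add: "tr (x\<^sup>2 + x) = cj x + x"
proof -
  have "(\<Sum>i<k. (x\<^sup>2 + x) ^ (2 ^ i)) = x ^ (2 ^ k) + x" for k
    by (induction k) (simp_all add: power_two_power_add add_ac flip: power_mult)
  then show ?thesis by (simp add: tr_def absolute_trace_def cj_def) (simp add: q_eq)
qed

lemma tr_square: "x \<in> K \<Longrightarrow> tr (x\<^sup>2) = tr x"
  using tr_square_add[of x] by (simp add: tr_add K_D add_eq_0)

subsection \<open>Traces and Artin-Schreier equations\<close>

lemma artin_schreier_fibre: "z\<^sup>2 + z = w\<^sup>2 + w \<longleftrightarrow> z = w \<or> z = w + (1::'a)"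
proof -
  have "(z\<^sup>2 + z) + (w\<^sup>2 + w) = (z + w) * (z + w + 1)"
    using square_add[of z w] by (simp add: algebra_simps power2_eq_square)
  then have "z\<^sup>2 + z = w\<^sup>2 + w \<longleftrightarrow> z + w = 0 \<or> z + (w + 1) = 0"
    using add_eq_0[of "z\<^sup>2 + z" "w\<^sup>2 + w"] by (simp add: add.assoc)
  then show ?thesis by (simp only: add_eq_0)
qed

lemma K_add: "x \<in> K \<Longrightarrow> y \<in> K \<Longrightarrow> x + y \<in> K"
  and K_mult: "x \<in> K \<Longrightarrow> y \<in> K \<Longrightarrow> x * y \<in> K"
  and K_divide: "x \<in> K \<Longrightarrow> y \<in> K \<Longrightarrow> x / y \<in> K"
  and K_power: "x \<in> K \<Longrightarrow> x ^ k \<in> K"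
  and K_1: "1 \<in> K" and K_0: "0 \<in> K"
  by (simp_all add: K_def)

lemma U_mult: "x \<in> U \<Longrightarrow> y \<in> U \<Longrightarrow> x * y \<in> U"
  and U_divide: "x \<in> U \<Longrightarrow> y \<in> U \<Longrightarrow> x / y \<in> U"
  and U_power: "x \<in> U \<Longrightarrow> x ^ k \<in> U"
  by (auto simp: U_cj U_nonzero field_simps intro!: U_I)

lemma ex_cj_add_1: obtains \<zeta> where "cj \<zeta> + \<zeta> = 1"
proof -
  obtain g where "g \<notin> K" by (rule ex_notin_K)
  then have "cj g + g \<noteq> 0" by (simp add: K_def add_eq_0)
  then have "cj (g / (cj g + g)) + g / (cj g + g) = 1"
    by (simp add: add.commute flip: add_divide_distrib)
  then show ?thesis by (rule that)
qed

text \<open>The map \<open>z\<^sup>2 + z\<close> sends the \<open>2 * card K\<close> elements of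
  \<open>K\<close> and \<open>\<zeta> + K\<close> into \<open>K\<close> and is at most two-to-one,
  so its image is all of \<open>K\<close>.\<close>

lemma artin_schreier_solvable:
  assumes "c \<in> K"
  obtains z where "z\<^sup>2 + z = c"
proof -
  obtain \<zeta> where \<zeta>: "cj \<zeta> + \<zeta> = 1" by (rule ex_cj_add_1)
  let ?\<phi> = "\<lambda>z::'a. z\<^sup>2 + z" and ?V = "K \<union> (+) \<zeta> ` K"
  have "K \<inter> (+) \<zeta> ` K = {}"
  proof -
    have "\<zeta> + x \<notin> K" if "x \<in> K" for x
    proof
      assume "\<zeta> + x \<in> K"
      then have "cj \<zeta> = \<zeta>" using that by (simp add: K_def)
      with \<zeta> show False by simp
    qed
    then show ?thesis by auto
  qed
  then have "card ?V = card K + card K"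
    by (simp add: card_Un_disjoint card_image)
  moreover have "card ?V \<le> card (\<Union>y\<in>?\<phi> ` ?V. {z. ?\<phi> z = y})"
    by (rule card_mono) auto
  moreover have "\<dots> \<le> (\<Sum>y\<in>?\<phi> ` ?V. card {z. ?\<phi> z = y})"
    by (rule card_UN_le) simp
  moreover have "\<dots> \<le> of_nat (card (?\<phi> ` ?V)) * 2"
  proof (rule sum_bounded_above)
    fix y assume "y \<in> ?\<phi> ` ?V"
    then obtain w where "y = ?\<phi> w" by blast
    then have "{z. ?\<phi> z = y} \<subseteq> {w, w + 1}" by (auto simp: artin_schreier_fibre)
    then have "card {z. ?\<phi> z = y} \<le> card {w, w + 1}" by (rule card_mono[rotated]) simp
    also have "\<dots> \<le> 2" by (simp add: card_insert_if)
    finally show "card {z. ?\<phi> z = y} \<le> 2" .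
  qed
  ultimately have "card K \<le> card (?\<phi> ` ?V)" by simp
  moreover have "?\<phi> ` ?V \<subseteq> K"
  proof -
    have "cj \<zeta> = \<zeta> + 1" using \<zeta> by (metis add.commute add_self_left)
    \<comment> \<open>Conjugation moves \<open>\<zeta> + x\<close> to
      \<open>\<zeta> + x + 1\<close>, the other point of the same fibre.\<close>
    then have "?\<phi> (\<zeta> + x) \<in> K" if "x \<in> K" for x
      using that artin_schreier_fibre[of "\<zeta> + 1 + x" "\<zeta> + x"] by (simp add: K_def add_ac)
    then show ?thesis by (auto intro: K_add K_power)
  qed
  ultimately have "?\<phi> ` ?V = K"
    by (intro card_seteq) auto
  with assms have "c \<in> ?\<phi> ` ?V" by simp
  then show ?thesis using that by (elim imageE) simp
qed

lemma tr_eq_0_iff: "z\<^sup>2 + z = c \<Longrightarrow> tr c = 0 \<longleftrightarrow> z \<in> K"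
  using tr_square_add[of z] by (auto simp: K_def add_eq_0)

lemma cj_artin_schreier:
  assumes "z\<^sup>2 + z = c" "c \<in> K"
  shows "cj z = z \<or> cj z = z + 1"
proof -
  have "(cj z)\<^sup>2 + cj z = cj (z\<^sup>2 + z)" by simp
  then show ?thesis using assms artin_schreier_fibre[of "cj z" z] by (simp add: K_D)
qed

text \<open>If \<open>\<gamma> \<noteq> 0\<close>, all of \<open>K\<close> has trace zero, so
  \<open>z\<^sup>2 + z\<close> maps \<open>K\<close> onto itself and is injective there; but it
  sends both 0 and 1 to 0.\<close>

lemma tr_nondegenerate:
  assumes "\<gamma> \<in> K" "\<And>x. x \<in> K \<Longrightarrow> tr (\<gamma> * x) = 0"
  shows "\<gamma> = 0"
proof (rule ccontr)
  assume "\<gamma> \<noteq> 0"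
  let ?\<phi> = "\<lambda>z::'a. z\<^sup>2 + z"
  have "K \<subseteq> ?\<phi> ` K"
  proof
    fix c assume c: "c \<in> K"
    then obtain z where z: "?\<phi> z = c" by (rule artin_schreier_solvable)
    have "tr c = 0" using assms(2)[of "c / \<gamma>"] assms(1) c \<open>\<gamma> \<noteq> 0\<close> by (simp add: K_divide)
    then show "c \<in> ?\<phi> ` K" using z tr_eq_0_iff[OF z] by blast
  qed
  then have "card K \<le> card (?\<phi> ` K)" by (rule card_mono[rotated]) simp
  then have "inj_on ?\<phi> K" by (intro eq_card_imp_inj_on antisym card_image_le) auto
  then show False
    using inj_onD[of ?\<phi> K 0 1] by (simp add: K_0 K_1)
qed

text \<open>As \<open>cj t = inverse t\<close> on \<open>U\<close>, multiplying the trace by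
  \<open>t ^ h\<close> with \<open>h = q div 2\<close> gives a polynomial \<open>p\<close> of degree
  at most \<open>q\<close>. If nonzero, it cannot vanish on the at least \<open>q + 1\<close> points
  of \<open>U\<close>.\<close>

lemma tr_linear_on_U:
  assumes "\<And>t. t \<in> U \<Longrightarrow> tr (\<kappa> * t + cj \<kappa> * cj t + c) = 0"
  shows "\<kappa> = 0"
proof (rule ccontr)
  assume "\<kappa> \<noteq> 0"
  define h :: nat where "h = 2 ^ (n - 1)"
  have q_h: "q = h + h"
    using n_pos by (cases n) (simp_all add: h_def q_eq)
  have le_h: "2 ^ i \<le> h" if "i < n" for i
    using that by (simp add: h_def)
  define p where "p = (\<Sum>i<n. Polynomial.monom (\<kappa> ^ 2 ^ i) (h + 2 ^ i) +
     (Polynomial.monom (cj \<kappa> ^ 2 ^ i) (h - 2 ^ i) + Polynomial.monom (c ^ 2 ^ i) h))"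
  \<comment> \<open>Only the last Frobenius power, \<open>i = n - 1\<close>, reaches exponent
    \<open>q\<close>; its coefficient is a power of \<open>\<kappa>\<close>.\<close>
  have eq_q: "h + 2 ^ i = q \<longleftrightarrow> i = n - 1" for i
    by (simp add: q_h h_def)
  have "coeff p q = (\<Sum>i<n. if i = n - 1 then \<kappa> ^ 2 ^ i else 0)"
    unfolding p_def coeff_sum
  proof (rule sum.cong[OF refl])
    fix i assume "i \<in> {..<n}"
    have "h \<noteq> q" "h - 2 ^ i \<noteq> q" using q_ge_2 by (auto simp: q_h)
    then show "coeff (Polynomial.monom (\<kappa> ^ 2 ^ i) (h + 2 ^ i) +
       (Polynomial.monom (cj \<kappa> ^ 2 ^ i) (h - 2 ^ i) + Polynomial.monom (c ^ 2 ^ i) h)) q =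
      (if i = n - 1 then \<kappa> ^ 2 ^ i else 0)"
      using eq_q[of i] by simp
  qed
  also have "\<dots> \<noteq> 0" using n_pos \<open>\<kappa> \<noteq> 0\<close> by simp
  finally have "p \<noteq> 0" by auto
  then have "card U \<le> degree p"
  proof (rule card_roots_le)
    fix t assume t: "t \<in> U"
    then have t0: "t \<noteq> 0" by (rule U_nonzero)
    have "poly p t = (\<Sum>i<n. t ^ h * (\<kappa> * t + (cj \<kappa> * cj t + c)) ^ 2 ^ i)"
      unfolding p_def poly_sum
      by (rule sum.cong)
         (use t t0 le_h in \<open>auto simp: poly_monom power_two_power_add U_cj power_mult_distrib
            power_add power_diff distrib_left field_simps\<close>)
    also have "\<dots> = t ^ h * tr (\<kappa> * t + cj \<kappa> * cj t + c)"
      by (simp add: tr_def absolute_trace_def sum_distrib_left add.assoc)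
    finally show "poly p t = 0" using assms[OF t] by simp
  qed
  also have "degree p \<le> q"
    unfolding p_def
  proof (intro degree_sum_le degree_add_le; simp?)
    fix i assume "i < n"
    then have "h + 2 ^ i \<le> q" "h - 2 ^ i \<le> q" "h \<le> q" using le_h[of i] by (simp_all add: q_h)
    then show "degree (Polynomial.monom (\<kappa> ^ 2 ^ i) (h + 2 ^ i)) \<le> q"
      "degree (Polynomial.monom (cj \<kappa> ^ 2 ^ i) (h - 2 ^ i)) \<le> q"
      "degree (Polynomial.monom (c ^ 2 ^ i) h) \<le> q"
      by (blast intro: degree_monom_le order_trans)+
  qed
  finally show False using card_U_ge by simp
qed

subsection \<open>Self-conjugate cubics and the permutation criterion\<close>

text \<open>Full expansion lets the simp rules \<open>add_self\<close> and
  \<open>add_self_left\<close> cancel equal monomials.\<close>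

lemmas char2_simps = algebra_simps eval_nat_numeral

lemma U_sqrt:
  assumes "v \<in> U"
  obtains l where "l \<in> U" "l\<^sup>2 = v"
proof -
  obtain l where l: "l\<^sup>2 = v" using ex_sqrt by blast
  have "(l * cj l)\<^sup>2 = 1\<^sup>2"
    using assms by (simp add: power_mult_distrib U_def l flip: cj_power)
  then have "l \<in> U" by (simp only: square_inj) (simp add: U_def)
  with l that show ?thesis by blast
qed

lemma U_add_cj_eq_0: "l \<in> U \<Longrightarrow> l + cj l = 0 \<longleftrightarrow> l = 1"
  using square_inj[of l 1] U_nonzero[of l]
  by (auto simp: add_eq_0 U_cj power2_eq_square field_simps)

text \<open>Under \<open>z = A * v / \<beta>\<close> the equation reads \<open>cj z = z + 1\<close>,
  and \<open>v \<in> U\<close> gives \<open>z * cj z = A * cj A / \<beta>\<^sup>2\<close>. Zeros on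
  \<open>U\<close> thus correspond to Artin-Schreier roots outside \<open>K\<close>.\<close>

lemma hermitian_quadratic_root_iff:
  assumes "A \<noteq> 0" "\<beta> \<noteq> 0" "\<beta> \<in> K"
  shows "(\<exists>v\<in>U. A * v + \<beta> + cj A * cj v = 0) \<longleftrightarrow> tr (A * cj A / \<beta>\<^sup>2) \<noteq> 0"
proof
  assume "\<exists>v\<in>U. A * v + \<beta> + cj A * cj v = 0"
  then obtain v where v: "v \<in> U" "cj A * cj v = A * v + \<beta>"
    by (auto simp: add_eq_0)
  define z where "z = A * v / \<beta>"
  have "z\<^sup>2 + z = A * v * (A * v + \<beta>) / \<beta>\<^sup>2"
    using assms(2) by (simp add: z_def field_simps power2_eq_square)
  also have "\<dots> = A * cj A / \<beta>\<^sup>2"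
    unfolding v(2)[symmetric] using v(1) U_nonzero by (simp add: U_cj)
  finally have z: "z\<^sup>2 + z = A * cj A / \<beta>\<^sup>2" .
  have "cj z = (A * v + \<beta>) / \<beta>"
    using assms(3) by (simp add: z_def v(2) K_D)
  then have "cj z = z + 1" using assms(2) by (simp add: z_def add_divide_distrib)
  then show "tr (A * cj A / \<beta>\<^sup>2) \<noteq> 0" using tr_eq_0_iff[OF z] by (simp add: K_def)
next
  assume nz: "tr (A * cj A / \<beta>\<^sup>2) \<noteq> 0"
  have K: "A * cj A / \<beta>\<^sup>2 \<in> K"
    using assms(3) by (simp add: K_def mult.commute)
  then obtain z where z: "z\<^sup>2 + z = A * cj A / \<beta>\<^sup>2" by (rule artin_schreier_solvable)
  with nz have cjz: "cj z = z + 1"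
    using cj_artin_schreier[OF z K] tr_eq_0_iff[OF z] by (auto simp: K_def)
  define v where "v = \<beta> * z / A"
  have cjv: "cj v = \<beta> * (z + 1) / cj A"
    using assms(3) by (simp add: v_def cjz K_D)
  have "v * cj v = \<beta>\<^sup>2 * (z\<^sup>2 + z) / (A * cj A)"
    unfolding cjv unfolding v_def by (simp add: field_simps power2_eq_square)
  also have "\<dots> = 1" unfolding z using assms by simp
  finally have "v \<in> U" by (simp add: U_def)
  moreover have "A * v + \<beta> + cj A * cj v = 0"
  proof -
    have "A * v = \<beta> * z" "cj A * cj v = \<beta> * (z + 1)"
      unfolding cjv unfolding v_def using assms by simp_all
    then show ?thesis by (simp add: distrib_left add_ac)
  qed
  ultimately show "\<exists>v\<in>U. A * v + \<beta> + cj A * cj v = 0" by blast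
qed

text \<open>The factor \<open>l + cj l\<close> vanishes only at 1 and squaring is a bijection of
  \<open>U\<close>, so the question is whether the second factor, as a function of
  \<open>v = l\<^sup>2\<close>, has a zero on \<open>U\<close> other than 1. \<open>Q = 0\<close>
  means that this function has a double zero (\<open>\<beta> = 0\<close>) or a zero at 1.\<close>

lemma hermitian_cubic_unique_root_iff:
  assumes "\<beta> \<in> K" "A \<noteq> 0 \<or> \<beta> \<noteq> 0"
  defines "P \<equiv> A * cj (A + \<beta>) + (A + \<beta>)\<^sup>2" and "Q \<equiv> \<beta> * (\<beta> + (A + cj A))"
  shows "(\<forall>l\<in>U. (l + cj l) * (A * l\<^sup>2 + \<beta> + cj A * (cj l)\<^sup>2) = 0 \<longrightarrow> l = 1) \<longleftrightarrow>
    (Q = 0 \<and> P = 0) \<or> (Q \<noteq> 0 \<and> tr (P * cj P / Q\<^sup>2 + 1) = 0)"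
    (is "?L \<longleftrightarrow> ?R")
proof -
  let ?h = "\<lambda>v. A * v + \<beta> + cj A * cj v"
  have L: "?L \<longleftrightarrow> (\<forall>v\<in>U. ?h v = 0 \<longrightarrow> v = 1)" (is "_ \<longleftrightarrow> ?L'")
  proof
    assume ?L
    show ?L'
    proof (intro ballI impI)
      fix v assume "v \<in> U" "?h v = 0"
      then obtain l where "l \<in> U" "l\<^sup>2 = v" by (auto elim: U_sqrt)
      with \<open>?L\<close> \<open>?h v = 0\<close> show "v = 1" by auto
    qed
  next
    assume ?L'
    show ?L
    proof (intro ballI impI)
      fix l assume l: "l \<in> U" "(l + cj l) * (A * l\<^sup>2 + \<beta> + cj A * (cj l)\<^sup>2) = 0"
      show "l = 1"
      proof (cases "l + cj l = 0")
        case True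
        then show ?thesis using l U_add_cj_eq_0 by blast
      next
        case False
        then have "?h (l\<^sup>2) = 0" using l by simp
        with \<open>?L'\<close> l(1) have "l\<^sup>2 = 1\<^sup>2" by (simp add: U_power)
        then show ?thesis by (simp only: square_inj)
      qed
    qed
  qed
  define \<sigma> where "\<sigma> = A + cj A"
  have \<sigma>K: "\<sigma> \<in> K" by (simp add: \<sigma>_def K_def add.commute)
  have P: "P = A * \<sigma> + A * \<beta> + \<beta>\<^sup>2"
    unfolding P_def \<sigma>_def using assms(1) by (simp add: K_D char2_simps)
  have Q: "Q = \<beta> * (\<beta> + \<sigma>)" by (simp add: Q_def \<sigma>_def)
  consider "\<beta> = 0" | "\<beta> \<noteq> 0" "\<sigma> = \<beta>" | "\<beta> \<noteq> 0" "\<sigma> \<noteq> \<beta>" by blast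
  then show ?thesis
  proof cases
    case 1
    then have A: "A \<noteq> 0" using assms(2) by simp
    have "?L' \<longleftrightarrow> \<sigma> = 0"
    proof
      assume ?L'
      have "cj A / A \<in> U" using A by (simp add: U_def)
      then obtain v where v: "v \<in> U" "v\<^sup>2 = cj A / A" by (rule U_sqrt)
      have "?h v = (A * v\<^sup>2 + cj A) / v"
        using 1 v(1) by (simp add: U_cj U_nonzero field_simps power2_eq_square)
      also have "\<dots> = 0" using v(2) A by simp
      finally have "v = 1" using \<open>?L'\<close> v(1) by blast
      then show "\<sigma> = 0" using v(2) A by (simp add: \<sigma>_def)
    next
      assume "\<sigma> = 0"
      then have cjA: "cj A = A" by (simp add: \<sigma>_def add_eq_0)
      show ?L'
      proof (intro ballI impI)
        fix v assume "v \<in> U" "?h v = 0"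
        then have "A * (v + cj v) = 0" using 1 by (simp add: cjA distrib_left)
        then show "v = 1" using A \<open>v \<in> U\<close> U_add_cj_eq_0 by simp
      qed
    qed
    then show ?thesis unfolding L P Q using 1 A by simp
  next
    case 2
    have A: "A \<noteq> 0" using 2 by (auto simp: \<sigma>_def)
    \<comment> \<open>The zeros are 1 and, from their product, \<open>cj A / A\<close>.\<close>
    have "cj A / A \<in> U" using A by (simp add: U_def)
    moreover have "?h (cj A / A) = 0"
      using A by (simp add: \<sigma>_def add_ac two_eq_0 flip: 2(2))
    moreover have "cj A / A \<noteq> 1" using A 2 by (auto simp: \<sigma>_def)
    ultimately have "\<not> ?L'" by blast
    moreover have "Q = 0" "P \<noteq> 0" using 2 by (simp_all add: P Q)
    ultimately show ?thesis unfolding L by simp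
  next
    case 3
    then have Q0: "Q \<noteq> 0" by (auto simp: Q add_eq_0)
    have s: "\<beta> + \<sigma> \<noteq> 0" using 3 by (auto simp: add_eq_0)
    \<comment> \<open>The trace arguments of the claim and of
      \<open>hermitian_quadratic_root_iff\<close> differ by \<open>y\<^sup>2 + y\<close>, which has
      trace zero for \<open>y \<in> K\<close>.\<close>
    define y where "y = \<beta> / (\<beta> + \<sigma>)"
    have "P * cj P = A * cj A * (\<beta> + \<sigma>)\<^sup>2 + \<sigma> * \<beta>\<^sup>2 * (\<beta> + \<sigma>) + \<beta> ^ 4"
      using assms(1) \<sigma>K unfolding P by (simp add: K_D) (simp add: \<sigma>_def char2_simps)
    also have "\<dots> = A * cj A * (\<beta> + \<sigma>)\<^sup>2 + \<beta>\<^sup>2 * ((\<beta> + \<sigma>)\<^sup>2 + \<beta> * (\<beta> + \<sigma>) + \<beta>\<^sup>2)"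
      by (simp add: char2_simps)
    finally have "P * cj P / Q\<^sup>2 + 1 = A * cj A / \<beta>\<^sup>2 + (y\<^sup>2 + y)"
      using s 3(1) by (simp add: Q y_def divide_simps) (simp add: char2_simps)
    moreover have "y \<in> K" using assms(1) \<sigma>K by (simp add: y_def K_add K_divide)
    ultimately have tr: "tr (P * cj P / Q\<^sup>2 + 1) = tr (A * cj A / \<beta>\<^sup>2)"
      by (simp add: tr_add[of "A * cj A / \<beta>\<^sup>2"] tr_square_add K_D)
    have "?h 1 \<noteq> 0" using s by (simp add: \<sigma>_def add_ac)
    then have "?L' \<longleftrightarrow> \<not> (\<exists>v\<in>U. ?h v = 0)" by auto
    also have "\<dots> \<longleftrightarrow> tr (A * cj A / \<beta>\<^sup>2) = 0"
    proof (cases "A = 0")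
      case True
      then show ?thesis using 3(1) tr_add[of 0 0] by (simp add: bex_triv_one_point1)
    next
      case False
      then show ?thesis using hermitian_quadratic_root_iff[of A \<beta>] 3(1) assms(1) by simp
    qed
    finally show ?thesis unfolding L tr using Q0 by simp
  qed
qed

lemma ex_U_nontrivial: obtains l where "l \<in> U" "l \<noteq> 1"
proof -
  have "\<not> U \<subseteq> {1}"
    using card_mono[of "{1::'a}" U] card_U_ge q_ge_2 by auto
  then show ?thesis using that by blast
qed

section \<open>Polar form of the trinomial and the permutation criterion\<close>

definition g :: "'a \<Rightarrow> 'a \<Rightarrow> 'a \<Rightarrow> 'a" where
  "g a b m = m + a * m ^ 3 + b * cj m ^ 3"

text \<open>Both exponents are 1 modulo \<open>q - 1\<close>, which pulls out \<open>c\<close>;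
  modulo \<open>q + 1\<close> they are 3 and -3, which settles the powers of
  \<open>m\<close>.\<close>

lemma poly_trinomial_polar:
  assumes "c \<in> K" "m \<in> U"
  shows "poly (trinomial q a b) (c * m) = c * g a b m"
proof (cases "c = 0")
  case True
  then show ?thesis by (simp add: trinomial_def poly_monom)
next
  case False
  let ?x = "c * m"
  have nz: "?x \<noteq> 0" "m \<noteq> 0" using False assms U_nonzero by auto
  have x: "cj ?x = c * inverse m" using assms by (simp add: K_D U_cj)
  have qq: "?x ^ (q * q) = ?x"
    using cj_cj[of ?x] by (simp only: cj_def power_mult)
  have "?x ^ (q * (q - 1) + 1) * cj ?x = ?x ^ (q * (q - 1) + 1 + q)"
    by (simp only: cj_def power_add)
  also have "q * (q - 1) + 1 + q = q * q + 1"
    using q_ge_2 by (simp add: diff_mult_distrib2)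
  also have "?x ^ (q * q + 1) = ?x\<^sup>2"
    by (simp only: power_add qq) (simp add: power2_eq_square)
  finally have 1: "?x ^ (q * (q - 1) + 1) = c * m ^ 3"
    unfolding x using nz False by (simp add: field_simps eval_nat_numeral)
  have "?x ^ (2 * (q - 1) + 1) * ?x = ?x ^ (2 * (q - 1) + 1 + 1)"
    by (simp only: power_add power_one_right)
  also have "2 * (q - 1) + 1 + 1 = q * 2" using q_ge_2 by simp
  also have "?x ^ (q * 2) = (cj ?x)\<^sup>2"
    by (simp only: cj_def power_mult)
  finally have 2: "?x ^ (2 * (q - 1) + 1) = c * inverse m ^ 3"
    unfolding x using nz False by (simp add: field_simps eval_nat_numeral)
  have "poly (trinomial q a b) ?x = ?x + a * ?x ^ (q * (q - 1) + 1) + b * ?x ^ (2 * (q - 1) + 1)"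
    by (simp add: trinomial_def poly_monom)
  also have "\<dots> = c * g a b m"
    unfolding 1 2 g_def using assms(2) by (simp add: U_cj algebra_simps)
  finally show ?thesis .
qed

text \<open>
  For \<^term>\<open>u = w\<^sup>2\<close> with \<^term>\<open>w \<in> U\<close>, these are the outer and middle coefficients of the
  Hessian of the cubic form attached to the direction \<^term>\<open>w\<close>.
\<close>

definition P :: "'a \<Rightarrow> 'a \<Rightarrow> 'a \<Rightarrow> 'a" where
  "P a b u = a + b * u + cj u"

definition D :: "'a \<Rightarrow> 'a \<Rightarrow> 'a \<Rightarrow> 'a" where
  "D a b u = 1 + a * cj a + b\<^sup>2 + b * (a * cj u + cj a * u)"

definition crit :: "'a \<Rightarrow> 'a \<Rightarrow> 'a \<Rightarrow> bool" where
  "crit a b u \<longleftrightarrow> (D a b u = 0 \<and> P a b u = 0) \<or>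
     (D a b u \<noteq> 0 \<and> tr (P a b u * cj (P a b u) / (D a b u)\<^sup>2 + 1) = 0)"

text \<open>
  The cubic form of direction \<^term>\<open>w\<close> vanishes at \<^term>\<open>k \<in> U\<close> iff \<^term>\<open>g a b k\<close> is a
  \<^term>\<open>K\<close>-multiple of \<^term>\<open>w\<close>. Substituting \<open>k = m * l\<close> moves the known root to \<open>l = 1\<close>.
\<close>

lemma unique_direction_iff:
  assumes b: "b \<in> K" and w: "w \<in> U" and m: "m \<in> U"
    and root: "cj w * g a b m + w * cj (g a b m) = 0"
  shows "(\<forall>k\<in>U. cj w * g a b k + w * cj (g a b k) = 0 \<longrightarrow> k = m) \<longleftrightarrow> crit a b (w\<^sup>2)"
proof -
  define A where "A = (a * cj w + b * w) * m ^ 3"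
  \<comment> \<open>The form is \<open>A * l ^ 3 + B * l\<close> plus its conjugate, with
    \<open>B = cj w * m\<close>. The root at \<open>l = 1\<close> says that \<open>A + B\<close>
    lies in \<open>K\<close>, and then \<open>l + cj l\<close> splits off.\<close>
  define \<beta> where "\<beta> = A + cj w * m"
  have cjb: "cj b = b" using b by (simp add: K_D)
  have nz: "m \<noteq> 0" "w \<noteq> 0" using m w U_nonzero by auto
  have expand: "cj w * g a b (m * l) + w * cj (g a b (m * l))
      = A * l ^ 3 + cj w * m * l + cj (A * l ^ 3 + cj w * m * l)" for l
    by (simp add: g_def A_def cjb algebra_simps power_mult_distrib)
  have "A + cj w * m + cj (A + cj w * m) = 0"
    using root expand[of 1] by simp
  then have \<beta>: "\<beta> \<in> K" unfolding \<beta>_def K_def by (simp only: add_eq_0 mem_Collect_eq)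
  have B: "cj w * m = A + \<beta>" by (simp add: \<beta>_def)
  have factor: "cj w * g a b (m * l) + w * cj (g a b (m * l))
      = (l + cj l) * (A * l\<^sup>2 + \<beta> + cj A * (cj l)\<^sup>2)" if "l \<in> U" for l
    unfolding expand B using that \<beta> U_nonzero[OF that]
    by (simp add: K_D U_cj field_simps) (simp add: char2_simps)
  have bij: "(\<forall>k\<in>U. R k \<longrightarrow> k = m) \<longleftrightarrow> (\<forall>l\<in>U. R (m * l) \<longrightarrow> l = 1)" for R
  proof
    assume *: "\<forall>k\<in>U. R k \<longrightarrow> k = m"
    show "\<forall>l\<in>U. R (m * l) \<longrightarrow> l = 1"
    proof (intro ballI impI)
      fix l assume "l \<in> U" "R (m * l)"
      then have "m * l = m" using *[rule_format, OF U_mult[OF m]] by simp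
      then show "l = 1" using nz by simp
    qed
  next
    assume *: "\<forall>l\<in>U. R (m * l) \<longrightarrow> l = 1"
    show "\<forall>k\<in>U. R k \<longrightarrow> k = m"
    proof (intro ballI impI)
      fix k assume "k \<in> U" "R k"
      then have "k / m = 1" using *[rule_format, of "k / m"] m nz by (simp add: U_divide)
      then show "k = m" using nz by simp
    qed
  qed
  have "A \<noteq> 0 \<or> \<beta> \<noteq> 0" using nz by (auto simp: \<beta>_def)
  note main = hermitian_cubic_unique_root_iff[OF \<beta> this]
  have Pw: "A * cj (A + \<beta>) + (A + \<beta>)\<^sup>2 = m\<^sup>2 * P a b (w\<^sup>2)"
    unfolding B[symmetric] unfolding A_def P_def using w m nz
    by (simp add: U_cj field_simps eval_nat_numeral)
  \<comment> \<open>Written with the norms of \<open>A + \<beta>\<close> and \<open>A\<close>, the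
    expression no longer depends on \<open>m\<close>.\<close>
  have "\<beta> * (\<beta> + (A + cj A)) = (A + \<beta>) * cj (A + \<beta>) + A * cj A"
    using \<beta> by (simp add: K_D char2_simps)
  also have "\<dots> = D a b (w\<^sup>2)"
    unfolding B[symmetric] unfolding A_def D_def using w m nz
    by (simp add: U_cj cjb field_simps eval_nat_numeral)
  finally have Dw: "\<beta> * (\<beta> + (A + cj A)) = D a b (w\<^sup>2)" .
  have N: "m\<^sup>2 * P a b (w\<^sup>2) * cj (m\<^sup>2 * P a b (w\<^sup>2)) = P a b (w\<^sup>2) * cj (P a b (w\<^sup>2))"
    using m nz by (simp add: U_cj field_simps)
  have "(\<forall>k\<in>U. cj w * g a b k + w * cj (g a b k) = 0 \<longrightarrow> k = m) \<longleftrightarrow>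
    (\<forall>l\<in>U. (l + cj l) * (A * l\<^sup>2 + \<beta> + cj A * (cj l)\<^sup>2) = 0 \<longrightarrow> l = 1)"
    unfolding bij using factor by auto
  also have "\<dots> \<longleftrightarrow> crit a b (w\<^sup>2)"
    unfolding main Pw Dw N crit_def using nz by simp
  finally show ?thesis .
qed

lemma parallel_iff:
  assumes "w \<in> U"
  shows "cj w * y + w * cj y = 0 \<longleftrightarrow> (\<exists>d\<in>K. y = d * w)"
proof
  assume "cj w * y + w * cj y = 0"
  then have "cj w * y \<in> K" by (simp add: add_eq_0 K_def)
  moreover have "y = cj w * y * w" using assms U_nonzero by (simp add: U_cj)
  ultimately show "\<exists>d\<in>K. y = d * w" by blast
qed (auto simp: K_D algebra_simps)

text \<open>Surjectivity provides, in each direction, the root that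
  \<open>unique_direction_iff\<close> presupposes. Conversely, finiteness reduces bijectivity to
  injectivity.\<close>

lemma permutation_iff_crit:
  assumes b: "b \<in> K"
  shows "permutation_polynomial (trinomial q a b) \<longleftrightarrow> (\<forall>u\<in>U. crit a b u)"
proof
  let ?f = "poly (trinomial q a b)"
  assume "permutation_polynomial (trinomial q a b)"
  then have bij: "bij ?f" by (simp add: permutation_polynomial_def)
  have f0: "?f 0 = 0" using poly_trinomial_polar[of 0 1] by (simp add: K_0)
  show "\<forall>u\<in>U. crit a b u"
  proof
    fix u assume "u \<in> U"
    then obtain w where w: "w \<in> U" "w\<^sup>2 = u" by (rule U_sqrt)
    then have w0: "w \<noteq> 0" by (simp add: U_nonzero)
    obtain x where "w = ?f x" using bij_is_surj[OF bij] by (rule surjE)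
    then have x: "?f x = w" by simp
    then have "x \<noteq> 0" using f0 w0 by auto
    then obtain c m where cm: "c \<in> K" "c \<noteq> 0" "m \<in> U" "x = c * m" by (rule polar)
    then have gm: "c * g a b m = w" using x poly_trinomial_polar by simp
    then have "g a b m = inverse c * w" using cm(2) by (simp add: field_simps)
    moreover have "inverse c \<in> K" using cm(1) by (simp add: K_def)
    ultimately have root: "cj w * g a b m + w * cj (g a b m) = 0"
      using parallel_iff[OF w(1)] by blast
    have "\<forall>k\<in>U. cj w * g a b k + w * cj (g a b k) = 0 \<longrightarrow> k = m"
    proof (intro ballI impI)
      fix k assume k: "k \<in> U" "cj w * g a b k + w * cj (g a b k) = 0"
      then obtain d where d: "d \<in> K" "g a b k = d * w" using parallel_iff[OF w(1)] by blast
      \<comment> \<open>A second root \<open>k\<close> has the same image as \<open>d * x\<close>,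
        so it is a \<open>K\<close>-multiple of \<open>m\<close>; comparing norms shows that the
        factor is 1.\<close>
      have "?f k = d * w" using poly_trinomial_polar[of 1 k] k(1) d by (simp add: K_1)
      also have "\<dots> = ?f (d * x)"
        using poly_trinomial_polar[of "d * c" m] d(1) cm gm by (simp add: K_mult mult.assoc)
      finally have "k = d * x" using bij by (simp add: bij_is_inj inj_eq)
      then have kc: "k = (d * c) * m" by (simp add: cm(4))
      have "d * c \<in> K" using d(1) cm(1) by (rule K_mult)
      moreover have "(d * c) * cj (d * c) * (m * cj m) = 1"
        using k(1) by (simp add: kc U_def mult_ac)
      ultimately have "(d * c)\<^sup>2 = 1\<^sup>2"
        using cm(3) by (simp only: K_D) (simp add: U_def power2_eq_square)
      then have "d * c = 1" by (simp only: square_inj)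
      then show "k = m" by (simp add: kc)
    qed
    then show "crit a b u" using unique_direction_iff[OF b w(1) cm(3) root] w(2) by simp
  qed
next
  let ?f = "poly (trinomial q a b)"
  assume crit: "\<forall>u\<in>U. crit a b u"
  have f0: "?f 0 = 0" using poly_trinomial_polar[of 0 1] by (simp add: K_0)
  have unique: "k = m" if "w \<in> U" "m \<in> U" "k \<in> U" "d \<in> K" "e \<in> K"
    "g a b m = d * w" "g a b k = e * w" for w m k d e
  proof -
    have "cj w * g a b m + w * cj (g a b m) = 0" "cj w * g a b k + w * cj (g a b k) = 0"
      using parallel_iff[OF that(1)] that by blast+
    then show "k = m"
      using unique_direction_iff[OF b that(1,2)] crit that by (meson U_power)
  qed
  have g_nz: "g a b m \<noteq> 0" if m: "m \<in> U" for m
  proof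
    \<comment> \<open>The value 0 is a multiple of every direction, so \<open>m\<close> would share
      the direction of \<open>g a b (m * l)\<close> with the different point
      \<open>m * l\<close>.\<close>
    assume 0: "g a b m = 0"
    obtain l where "l \<in> U" "l \<noteq> 1" by (rule ex_U_nontrivial)
    then have k: "m * l \<in> U" "m * l \<noteq> m" using m by (auto simp: U_mult U_nonzero)
    obtain d w where "d \<in> K" "w \<in> U" "g a b (m * l) = d * w"
    proof (cases "g a b (m * l) = 0")
      case True
      then show ?thesis using that[of 0 1] by (simp add: K_0)
    next
      case False
      then show ?thesis using that by (auto elim: polar)
    qed
    then show False using unique[of w m "m * l" 0 d] m k 0 by (simp add: K_0)
  qed
  have "inj ?f"
  proof (rule injI)
    fix x y assume eq: "?f x = ?f y"
    have nz: "?f z \<noteq> 0" if z: "z \<noteq> 0" for z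
    proof -
      obtain c m where "c \<in> K" "c \<noteq> 0" "m \<in> U" "z = c * m" using z by (rule polar)
      then show ?thesis by (simp add: poly_trinomial_polar g_nz)
    qed
    show "x = y"
    proof (cases "x = 0 \<or> y = 0")
      case True
      then show ?thesis using eq nz[of x] nz[of y] f0 by (cases "y = 0") auto
    next
      case False
      then obtain c m where x: "c \<in> K" "c \<noteq> 0" "m \<in> U" "x = c * m" using polar[of x] by blast
      obtain d k where y: "d \<in> K" "d \<noteq> 0" "k \<in> U" "y = d * k" using False polar[of y] by blast
      obtain s w where w: "s \<in> K" "s \<noteq> 0" "w \<in> U" "g a b m = s * w"
        using g_nz[OF x(3)] by (rule polar)
      have e: "c * (s * w) = d * g a b k"
        using eq x y w by (simp add: poly_trinomial_polar)
      then have "g a b k = (c * s / d) * w" using y(2) by (simp add: field_simps)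
      then have km: "k = m"
        using unique[of w m k s "c * s / d"] w x y by (simp add: K_mult K_divide)
      then have "c = d" using e w by (auto simp: U_nonzero)
      then show ?thesis using x y km by simp
    qed
  qed
  then show "permutation_polynomial (trinomial q a b)"
    unfolding permutation_polynomial_def by (simp add: bij_def finite_UNIV_inj_surj)
qed

subsection \<open>Solving the criterion\<close>

lemma norm_P:
  assumes "a \<in> K" "b \<in> K" "u \<in> U"
  shows "P a b u * cj (P a b u) = D a b u + a * (u + cj u) + b * (u + cj u)\<^sup>2"
  using assms by (simp add: P_def D_def K_D U_cj U_nonzero field_simps) (simp add: char2_simps)

lemma D_in_K: "b \<in> K \<Longrightarrow> D a b u \<in> K"
  by (simp add: D_def K_def algebra_simps)

text \<open>Here \<open>P\<close> is self-conjugate and \<open>D = a * P\<close>, so where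
  \<open>P\<close> is nonzero the quotient in \<open>crit\<close> is the constant
  \<open>1 / a\<^sup>2\<close>.\<close>

lemma crit_if_b_1:
  assumes "a \<in> K" "a \<noteq> 0" "tr (1 + inverse a) = 0" "u \<in> U"
  shows "crit a 1 u"
proof -
  have P: "P a 1 u = a + (u + cj u)" by (simp add: P_def add.assoc)
  have cjP: "cj (P a 1 u) = P a 1 u" using assms(1) by (simp add: P K_D add_ac)
  have D: "D a 1 u = a * P a 1 u"
    using assms(1) by (simp add: D_def P K_D char2_simps)
  show ?thesis
  proof (cases "P a 1 u = 0")
    case True
    then show ?thesis by (simp add: crit_def D)
  next
    case False
    have "P a 1 u * cj (P a 1 u) / (D a 1 u)\<^sup>2 + 1 = (1 + inverse a)\<^sup>2"
      unfolding cjP D square_add using False assms(2)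
      by (simp add: power2_eq_square field_simps)
    moreover have "1 + inverse a \<in> K" using assms(1) by (simp add: K_def)
    ultimately show ?thesis
      using False assms(2,3) by (simp add: crit_def tr_square D)
  qed
qed

lemma square_in_K: "x\<^sup>2 \<in> K \<longleftrightarrow> x \<in> K"
  by (simp add: K_def square_inj)

text \<open>The relation for \<open>a\<close> makes \<open>D\<close> affine in
  \<open>s = u + cj u\<close>. The trace condition excludes a zero of \<open>D\<close> and then
  annihilates the constant part of the quotient in \<open>crit\<close>.\<close>

lemma crit_if_square_eq:
  assumes b: "b \<in> K" "b \<noteq> 0" "b \<noteq> 1" and a: "a\<^sup>2 = b * (b + 1)"
    and tr: "tr (b / (b + 1)) = 0" and u: "u \<in> U"
  shows "crit a b u"
proof -
  have b1: "b + 1 \<noteq> 0" using b(3) by (simp add: add_eq_0)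
  have a0: "a \<noteq> 0" using a b(2) b1 by auto
  have "a\<^sup>2 \<in> K" unfolding a using b(1) by (intro K_mult K_add K_1)
  then have aK: "a \<in> K" by (simp only: square_in_K)
  define s where "s = u + cj u"
  have sK: "cj s = s" by (simp add: s_def add.commute)
  have "D a b u = 1 + a\<^sup>2 + b\<^sup>2 + b * (a * s)"
    using aK by (simp add: D_def s_def K_D power2_eq_square algebra_simps)
  also have "\<dots> = b + 1 + a * b * s" unfolding a by (simp add: char2_simps)
  finally have D: "D a b u = b + 1 + a * b * s" .
  have D0: "D a b u \<noteq> 0"
  proof
    assume "D a b u = 0"
    then have abs: "a * b * s = b + 1" using D by (simp add: add_eq_0)
    then have s0: "s \<noteq> 0" using b1 by auto
    \<comment> \<open>\<open>u / s\<close> is an Artin-Schreier root of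
      \<open>1 / s\<^sup>2\<close>. A zero of \<open>D\<close> determines \<open>s\<^sup>2\<close>
      so that this has trace zero, which puts \<open>u / s\<close>, hence \<open>u\<close>, in
      \<open>K\<close>.\<close>
    have "(u / s)\<^sup>2 + u / s = u * (u + s) / s\<^sup>2"
      using s0 by (simp add: field_simps power2_eq_square)
    also have "u * (u + s) = 1" using u U_nonzero by (simp add: s_def U_cj)
    also have "1 / s\<^sup>2 = (b\<^sup>2 + b) + b / (b + 1)"
    proof -
      have "(b + 1)\<^sup>2 = a\<^sup>2 * b\<^sup>2 * s\<^sup>2"
        unfolding abs[symmetric] by (simp add: power_mult_distrib)
      then have "(b + 1)\<^sup>2 = b * (b + 1) * b\<^sup>2 * s\<^sup>2" by (simp only: a)
      then have *: "b + 1 = b ^ 3 * s\<^sup>2" using b1 by (simp add: eval_nat_numeral)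
      have "((b\<^sup>2 + b) + b / (b + 1)) * s\<^sup>2 = b ^ 3 * s\<^sup>2 / (b + 1)"
        using b1 by (simp add: field_simps) (simp add: char2_simps)
      also have "\<dots> = 1" using * b1 by simp
      finally show ?thesis using s0 by (simp add: divide_eq_eq)
    qed
    finally have z: "(u / s)\<^sup>2 + u / s = (b\<^sup>2 + b) + b / (b + 1)" .
    have "tr ((b\<^sup>2 + b) + b / (b + 1)) = 0"
      using b(1) by (simp add: tr_add[of "b\<^sup>2 + b"] tr_square_add K_D tr)
    then have "cj (u / s) = u / s" using tr_eq_0_iff[OF z] by (simp add: K_def)
    then have "cj u = u" using s0 by (simp add: sK)
    then show False using s0 by (simp add: s_def)
  qed
  \<comment> \<open>Expanding the norm of \<open>P\<close> over the square of \<open>D\<close> in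
    powers of \<open>1 / D\<close>, the nonconstant terms are \<open>y\<^sup>2\<close> and
    \<open>y\<close>.\<close>
  define y where "y = (b + 1) / (b * D a b u)"
  have yK: "y \<in> K" unfolding y_def using b(1) by (intro K_divide K_add K_mult D_in_K K_1)
  define N where "N = P a b u * cj (P a b u)"
  define d where "d = D a b u"
  have abs: "a * b * s = d + b + 1"
    unfolding d_def D by (simp add: add_ac)
  \<comment> \<open>The factor \<open>b\<^sup>2 * (b + 1)\<close> turns \<open>b * s\<^sup>2\<close>
    into \<open>(a * b * s)\<^sup>2\<close>, so the norm becomes a polynomial in
    \<open>d\<close>.\<close>
  have "b\<^sup>2 * (b + 1) * N = b\<^sup>2 * (b + 1) * d + b * (b + 1) * (a * b * s) + (b * (b + 1)) * (b\<^sup>2 * s\<^sup>2)"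
    unfolding N_def norm_P[OF aK b(1) u] s_def[symmetric] d_def[symmetric]
    by (simp add: algebra_simps power2_eq_square)
  also have "b * (b + 1) * (b\<^sup>2 * s\<^sup>2) = (a * b * s)\<^sup>2"
    unfolding a[symmetric] by (simp add: power_mult_distrib)
  also have "b\<^sup>2 * (b + 1) * d + b * (b + 1) * (a * b * s) + (a * b * s)\<^sup>2
     = (b + 1) ^ 3 + (b + 1)\<^sup>2 * b * d + d\<^sup>2"
    unfolding abs by (simp add: char2_simps)
  finally have N: "b\<^sup>2 * (b + 1) * N = (b + 1) ^ 3 + (b + 1)\<^sup>2 * b * d + d\<^sup>2" .
  have d0: "d \<noteq> 0" using D0 by (simp add: d_def)
  have "N / d\<^sup>2 = (b\<^sup>2 * (b + 1) * N) / (b\<^sup>2 * (b + 1) * d\<^sup>2)" using b(2) b1 by simp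
  also have "\<dots> = y\<^sup>2 + y + 1 / (b\<^sup>2 * (b + 1))"
    unfolding N y_def d_def[symmetric] using b(2) b1 d0
    by (simp add: divide_simps) (simp add: char2_simps)
  also have "1 / (b\<^sup>2 * (b + 1)) = (1 / b)\<^sup>2 + 1 / b + (b / (b + 1) + 1)"
    using b(2) b1 by (simp add: divide_simps) (simp add: char2_simps)
  finally have "N / d\<^sup>2 + 1 = (y\<^sup>2 + y) + (((1 / b)\<^sup>2 + 1 / b) + b / (b + 1))"
    by (simp add: add_ac)
  moreover have "1 / b \<in> K" using b(1) by (intro K_divide K_1)
  ultimately have "tr (N / d\<^sup>2 + 1) = 0"
    using yK by (simp only: tr_add[of "y\<^sup>2 + y"] tr_add[of "(1 / b)\<^sup>2 + 1 / b"] tr_square_add K_D tr) simp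
  then show ?thesis using D0 by (simp add: crit_def N_def d_def)
qed

section \<open>Necessity of the two families\<close>

lemma K_independent_eq:
  assumes "x \<notin> K" "\<alpha> \<in> K" "\<beta> \<in> K" "\<alpha>' \<in> K" "\<beta>' \<in> K" "\<alpha> * x + \<beta> = \<alpha>' * x + \<beta>'"
  shows "\<alpha> = \<alpha>'" "\<beta> = \<beta>'"
proof -
  show "\<alpha> = \<alpha>'"
  proof (rule ccontr)
    assume "\<alpha> \<noteq> \<alpha>'"
    then have nz: "\<alpha> - \<alpha>' \<noteq> 0" by simp
    have "(\<alpha> - \<alpha>') * x = \<beta>' - \<beta>" using assms(6) by (simp add: algebra_simps)
    then have "x = (\<beta>' + \<beta>) / (\<alpha> + \<alpha>')"
      using nz by (simp add: minus_eq_plus eq_divide_eq mult.commute)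
    then show False using assms by (simp add: K_add K_divide)
  qed
  then show "\<beta> = \<beta>'" using assms(6) by simp
qed

text \<open>At \<open>u = 1\<close> the terms in \<open>u + cj u\<close> vanish, so the norm of
  \<open>P\<close> equals \<open>D\<close>. This yields the trace conditions of both
  families.\<close>

lemma crit_at_1:
  assumes "crit a b 1" "b \<in> K" "a \<in> K" "1 + a\<^sup>2 + b\<^sup>2 \<noteq> 0"
  shows "tr (1 / (1 + a\<^sup>2 + b\<^sup>2) + 1) = 0"
proof -
  have D: "D a b 1 = 1 + a\<^sup>2 + b\<^sup>2" using assms(3) by (simp add: D_def K_D power2_eq_square)
  have "P a b 1 * cj (P a b 1) = D a b 1"
    using norm_P[OF assms(3,2) one_in_U] by simp
  then show ?thesis using assms(1,4) by (simp add: crit_def D power2_eq_square)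
qed

text \<open>
  Here \<open>D\<close> would have a double zero on \<^term>\<open>U\<close>, necessarily at \<open>1\<close>. The points of
  \<^term>\<open>U\<close> other than \<open>1\<close> are \<open>(z + 1) / z\<close> with \<open>z + cj z = 1\<close>, that is, \<open>z = \<zeta> + x\<close> with
  \<^term>\<open>x \<in> K\<close>, which makes the trace condition additive in \<open>x\<close>.
\<close>

lemma crit_imp_nondegenerate:
  assumes b: "b \<in> K" "b \<noteq> 0" and a0: "a \<noteq> 0" and crit: "\<And>u. u \<in> U \<Longrightarrow> crit a b u"
  shows "1 + a * cj a + b\<^sup>2 \<noteq> 0"
proof
  assume e: "1 + a * cj a + b\<^sup>2 = 0"
  have "a / cj a \<in> U" using a0 by (simp add: U_def)
  \<comment> \<open>This choice gives \<open>a * cj r = cj a * r\<close>, so \<open>D a b r\<close>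
    collapses to the expression assumed zero.\<close>
  then obtain r where r: "r \<in> U" "r\<^sup>2 = a / cj a" by (rule U_sqrt)
  then have r0: "r \<noteq> 0" by (simp add: U_nonzero)
  have ar: "a = cj a * r\<^sup>2" using r a0 by simp
  have "a * cj r = cj a * r * (r * cj r)"
    by (subst ar) (simp add: power2_eq_square mult_ac)
  also have "\<dots> = cj a * r" using r(1) by (simp add: U_def)
  finally have "D a b r = 0" using e by (simp add: D_def)
  then have "P a b r = 0" using crit[OF r(1)] by (simp add: crit_def)
  then have a_r: "a = b * r + cj r" by (simp add: P_def add_eq_0 add.assoc)
  then have cja: "cj a = b * cj r + r" using b(1) by (simp add: K_D)
  have rr: "r * cj r = 1" using r(1) by (simp add: U_def)
  have "b * r + cj r = cj a * r\<^sup>2" by (rule trans[OF a_r[symmetric] ar])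
  also have "\<dots> = (b * cj r + r) * r\<^sup>2" by (simp only: cja)
  also have "\<dots> = b * r * (r * cj r) + r ^ 3"
    by (simp add: algebra_simps eval_nat_numeral)
  finally have "cj r = r ^ 3" by (simp add: rr)
  then have "(r\<^sup>2)\<^sup>2 = 1\<^sup>2" using rr by (simp add: eval_nat_numeral mult_ac)
  then have "r = 1" using square_inj[of "r\<^sup>2" 1] square_inj[of r 1] by simp
  then have a: "a = b + 1" using a_r by simp
  then have aK: "a \<in> K" using b(1) by (simp add: K_add K_1)
  obtain \<zeta> where \<zeta>: "cj \<zeta> + \<zeta> = 1" by (rule ex_cj_add_1)
  have key: "tr ((\<zeta>\<^sup>2 + \<zeta> + (x\<^sup>2 + x)) / b\<^sup>2 + (1 / (b * a\<^sup>2) + 1)) = 0" if x: "x \<in> K" for x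
  proof -
    define z where "z = \<zeta> + x"
    have cjz: "cj z = z + 1"
      using \<zeta> x by (simp add: z_def K_D) (metis add.assoc add.commute add_self_left)
    have z0: "z \<noteq> 0" "z + 1 \<noteq> 0" using cjz by auto
    define u where "u = (z + 1) / z"
    have cju: "cj u = z / (z + 1)" by (simp add: u_def cjz two_eq_0)
    have u: "u \<in> U" using z0 by (simp add: U_def cju) (simp add: u_def)
    define s where "s = u + cj u"
    have s: "s = 1 / (z\<^sup>2 + z)"
    proof -
      have "s = ((z + 1) * (z + 1) + z * z) / (z * (z + 1))"
        unfolding s_def cju unfolding u_def using z0 by (simp add: add_frac_eq)
      also have "(z + 1) * (z + 1) + z * z = 1" by (simp add: char2_simps)
      finally show ?thesis by (simp add: power2_eq_square distrib_left)
    qed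
    have "z\<^sup>2 + z = z * (z + 1)" by (simp add: power2_eq_square distrib_left)
    then have s0: "s \<noteq> 0" using s z0 by simp
    have D: "D a b u = b * a * s"
      using e aK by (simp add: D_def s_def K_D algebra_simps)
    then have D0: "D a b u \<noteq> 0" using b(2) a0 s0 by simp
    have "P a b u * cj (P a b u) / (D a b u)\<^sup>2 = (b * a * s + a * s + b * s\<^sup>2) / (b * a * s)\<^sup>2"
      unfolding norm_P[OF aK b(1) u] s_def[symmetric] D ..
    also have "b * a * s + a * s + b * s\<^sup>2 = a\<^sup>2 * s + b * s\<^sup>2"
      unfolding a by (simp add: char2_simps)
    also have "(a\<^sup>2 * s + b * s\<^sup>2) / (b * a * s)\<^sup>2 = (1 / s) / b\<^sup>2 + 1 / (b * a\<^sup>2)"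
      using b(2) a0 s0 by (simp add: field_simps eval_nat_numeral)
    also have "1 / s = \<zeta>\<^sup>2 + \<zeta> + (x\<^sup>2 + x)"
      unfolding s z_def by (simp add: square_add add_ac)
    finally show ?thesis
      using crit[OF u] D0 by (simp add: crit_def add.assoc)
  qed
  \<comment> \<open>Adding the conditions at \<open>x\<close> and at 0 removes the constants, and
    \<open>(x / b)\<^sup>2\<close> has the same trace as \<open>x / b\<close>; what remains is
    linear in \<open>x\<close> with this coefficient.\<close>
  have "1 / b + 1 / b\<^sup>2 = 0"
  proof (rule tr_nondegenerate)
    show "1 / b + 1 / b\<^sup>2 \<in> K" using b(1) by (intro K_add K_divide K_power K_1)
    fix x assume x: "x \<in> K"
    have "tr ((x / b)\<^sup>2 + x / b\<^sup>2) =
      tr ((\<zeta>\<^sup>2 + \<zeta> + (x\<^sup>2 + x)) / b\<^sup>2 + (1 / (b * a\<^sup>2) + 1)) +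
      tr ((\<zeta>\<^sup>2 + \<zeta> + (0\<^sup>2 + 0)) / b\<^sup>2 + (1 / (b * a\<^sup>2) + 1))"
      unfolding tr_add[symmetric] by (simp add: add_divide_distrib power_divide add_ac)
    also have "\<dots> = 0" using key[OF x] key[OF K_0] by simp
    finally have "tr (x / b) + tr (x / b\<^sup>2) = 0"
      using x b(1) by (simp add: tr_add tr_square K_divide)
    then show "tr ((1 / b + 1 / b\<^sup>2) * x) = 0"
      by (simp add: distrib_right flip: tr_add)
  qed
  then have "b = 1" using b(2) by (simp add: field_simps power2_eq_square add_eq_0)
  then show False using a a0 by simp
qed

text \<open>\<open>D\<close> has a second zero \<open>r'\<close> on \<open>U\<close>, distinct from
  \<open>r\<close> by \<open>e0\<close>. The criterion makes both roots of
  \<open>b * v\<^sup>2 + a * v + 1\<close>, so \<open>a = b * (r + r')\<close> and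
  \<open>b * (r * r') = 1\<close>; norms then give \<open>b = 1\<close>.\<close>

lemma crit_imp_if_root_in_U:
  assumes b: "b \<in> K" "b \<noteq> 0" and a0: "a \<noteq> 0" and e0: "1 + a * cj a + b\<^sup>2 \<noteq> 0"
    and crit: "\<And>u. u \<in> U \<Longrightarrow> crit a b u" and r: "r \<in> U" and Dr: "D a b r = 0"
  shows "b = 1 \<and> a \<in> K"
proof -
  \<comment> \<open>On \<open>U\<close>, \<open>v * D a b v\<close> is a quadratic in
    \<open>v\<close> whose roots have product \<open>a / cj a\<close>.\<close>
  define r' where "r' = a / (cj a * r)"
  have r0: "r \<noteq> 0" using r by (rule U_nonzero)
  have r': "r' \<in> U" using r a0 r0 by (intro U_I) (simp_all add: r'_def U_cj field_simps)
  have cjr': "cj r' = cj a * r / a"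
    using r' a0 r0 by (simp add: U_cj) (simp add: r'_def)
  have "a * cj r' + cj a * r' = a * cj r + cj a * r"
    unfolding cjr' unfolding r'_def using r a0 r0 by (simp add: U_cj field_simps)
  then have Dr': "D a b r' = 0" using Dr by (simp add: D_def)
  have ne: "r \<noteq> r'"
  proof
    assume "r = r'"
    then have "a * cj r = cj a * r" using cjr' a0 by simp
    then have "D a b r = 1 + a * cj a + b\<^sup>2" by (simp add: D_def)
    then show False using Dr e0 by simp
  qed
  have root: "b * v\<^sup>2 + a * v + 1 = 0" if v: "v \<in> U" "D a b v = 0" for v
  proof -
    have "P a b v = 0" using crit[OF v(1)] v(2) by (simp add: crit_def)
    then have "P a b v * v = 0" by simp
    then show ?thesis using v(1) U_nonzero[OF v(1)]
      by (simp add: P_def U_cj algebra_simps power2_eq_square)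
  qed
  have "(r + r') * (b * (r + r') + a) = (b * r\<^sup>2 + a * r + 1) + (b * r'\<^sup>2 + a * r' + 1)"
    by (simp add: char2_simps)
  also have "\<dots> = 0" using root[OF r Dr] root[OF r' Dr'] by simp
  finally have a: "a = b * (r + r')" using ne by (simp add: add_eq_0)
  have "b * (r * r') + 1 = b * r\<^sup>2 + a * r + 1" unfolding a by (simp add: char2_simps)
  also have "\<dots> = 0" using root[OF r Dr] .
  finally have brr: "b * (r * r') = 1" by (simp add: add_eq_0)
  then have "cj (b * (r * r')) = 1" by simp
  then have "b * cj (r * r') = 1" using b(1) by (simp add: K_D)
  then have "(b * (r * r')) * (b * cj (r * r')) = 1" using brr by simp
  then have "b\<^sup>2 * ((r * r') * cj (r * r')) = 1\<^sup>2" by (simp add: power2_eq_square mult_ac)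
  moreover have "(r * r') * cj (r * r') = 1" using U_mult[OF r r'] unfolding U_def by blast
  ultimately have "b\<^sup>2 = 1\<^sup>2" by (simp only: mult_1_right)
  then have b1: "b = 1" by (simp only: square_inj)
  then have "r' = inverse r" using brr r0 by (simp add: field_simps)
  then have "a = r + cj r" using a b1 r by (simp add: U_cj)
  then have "a \<in> K" by (simp add: K_def add.commute)
  with b1 show ?thesis by simp
qed

text \<open>
  With \<^term>\<open>r\<close> a root of \<^term>\<open>D a b\<close> outside the unit circle, the substitution
  \<open>u = (t + r) / (cj r * t + 1)\<close> moves both poles to \<open>0\<close> and \<open>\<infinity>\<close>, and the trace condition
  becomes that of a Laurent polynomial in \<open>t\<close>.
\<close>

lemma crit_imp_coefficient_eq:
  assumes \<rho>: "\<rho> \<in> K" "\<rho> \<noteq> 0" and b: "b \<in> K" "b \<noteq> 0" and r: "r * cj r \<noteq> 1"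
    and crit: "\<And>u. u \<in> U \<Longrightarrow> crit (\<rho> * r) b u"
    and e: "1 + \<rho>\<^sup>2 * (r * cj r) + b\<^sup>2 = b * \<rho> * (1 + r * cj r)"
  shows "(b * cj r * (1 + r * cj r) + cj r ^ 3 + r)\<^sup>2 =
    b\<^sup>2 * (1 + r * cj r)\<^sup>2 * ((\<rho> * (r * cj r) + b + (cj r)\<^sup>2) * (\<rho> * (cj r)\<^sup>2 + b * (cj r)\<^sup>2 + 1))"
proof -
  define r' where "r' = cj r"
  define \<delta> where "\<delta> = 1 + r * r'"
  define p0 where "p0 = \<rho> * r\<^sup>2 + b * r\<^sup>2 + 1"
  define p1 where "p1 = \<rho> * r * \<delta>"
  define p2 where "p2 = \<rho> * (r * r') + b + r'\<^sup>2"
  define c2 where "c2 = p2 * cj p0"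
  define c1 where "c1 = p2 * cj p1 + p1 * cj p0"
  define c0 where "c0 = p0 * cj p0 + p1 * cj p1 + p2 * cj p2"
  define \<gamma> where "\<gamma> = b * \<rho> * \<delta>\<^sup>2"
  have cjr: "cj r = r'" "cj r' = r" by (simp_all add: r'_def)
  have cjK: "cj \<rho> = \<rho>" "cj b = b" using \<rho>(1) b(1) by (simp_all add: K_D)
  have cj\<delta>: "cj \<delta> = \<delta>" by (simp add: \<delta>_def cjr mult.commute)
  have cj\<gamma>: "cj \<gamma> = \<gamma>" by (simp add: \<gamma>_def cjK cj\<delta>)
  have \<delta>0: "\<delta> \<noteq> 0" using r by (auto simp: \<delta>_def r'_def add_eq_0)
  then have \<gamma>0: "\<gamma> \<noteq> 0" using b(2) \<rho>(2) by (simp add: \<gamma>_def)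
  \<comment> \<open>The degree-two part of the numerator is the square of an element of
    \<open>K\<close>, which has the same trace as its square. Thus \<open>h\<close> lowers that part
    to degree one and \<open>\<kappa>\<close> collects the coefficient of \<open>t\<close>.\<close>
  obtain h where h: "h\<^sup>2 = c2" using ex_sqrt by blast
  define \<kappa> where "\<kappa> = h / \<gamma> + c1 / \<gamma>\<^sup>2"
  have "\<kappa> = 0"
  proof (rule tr_linear_on_U)
    fix t assume t: "t \<in> U"
    define t' where "t' = cj t"
    have tt: "t * t' = 1" using t by (simp add: U_def t'_def)
    have cjt: "cj t = t'" "cj t' = t" by (simp_all add: t'_def)
    define V where "V = t + r"
    define Y where "Y = r' * t + 1"
    have cjV: "cj V = t' * Y" and cjY: "cj Y = t' * V"
    proof -
      have "t' * Y = r' * (t * t') + t'" by (simp add: Y_def algebra_simps)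
      then show "cj V = t' * Y" by (simp add: tt V_def cjt cjr add.commute)
      have "t' * V = t * t' + r * t'" by (simp add: V_def algebra_simps)
      then show "cj Y = t' * V" by (simp add: tt Y_def cjt cjr add.commute)
    qed
    have t0: "t \<noteq> 0" "t' \<noteq> 0" using tt by auto
    have Y0: "Y \<noteq> 0"
    proof
      assume "Y = 0"
      then have "V = 0" using cjY t0 by simp
      then have "t = r" by (simp add: V_def add_eq_0)
      then show False using tt r by (simp add: t'_def)
    qed
    then have V0: "V \<noteq> 0" using cjV t0 by auto
    define u where "u = V / Y"
    have cju: "cj u = Y / V" using t0 by (simp add: u_def cjV cjY)
    have uU: "u \<in> U" using V0 Y0 by (simp add: U_def cju) (simp add: u_def)
    define p where "p = p2 * t\<^sup>2 + p1 * t + p0"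
    have VY: "D (\<rho> * r) b u * (V * Y) = \<gamma> * t"
    proof -
      \<comment> \<open>Hypothesis \<open>e\<close> is the root equation of \<open>r\<close>; it
        cancels the constant and quadratic terms in \<open>t\<close>.\<close>
      have "1 + \<rho> * r * cj (\<rho> * r) + b\<^sup>2 = b * \<rho> * \<delta>"
        using e by (simp add: cjr cjK \<delta>_def power2_eq_square mult_ac)
      then have "D (\<rho> * r) b u * (V * Y) = b * \<rho> * (\<delta> * V * Y + r * Y\<^sup>2 + r' * V\<^sup>2)"
        unfolding D_def cju unfolding u_def using V0 Y0
        by (simp add: cjr cjK field_simps power2_eq_square)
      also have "\<delta> * V * Y + r * Y\<^sup>2 + r' * V\<^sup>2 = \<delta>\<^sup>2 * t"
        by (simp add: \<delta>_def V_def Y_def char2_simps)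
      finally show ?thesis by (simp add: \<gamma>_def)
    qed
    have PVY: "P (\<rho> * r) b u * (V * Y) = p"
    proof -
      have "P (\<rho> * r) b u * (V * Y) = \<rho> * r * V * Y + b * V\<^sup>2 + Y\<^sup>2"
        unfolding P_def cju unfolding u_def using V0 Y0
        by (simp add: field_simps power2_eq_square)
      also have "\<dots> = p"
        by (simp add: p_def p0_def p1_def p2_def \<delta>_def V_def Y_def char2_simps)
      finally show ?thesis .
    qed
    have D: "D (\<rho> * r) b u = \<gamma> * t / (V * Y)" using VY V0 Y0 by (simp add: field_simps)
    have P: "P (\<rho> * r) b u = p / (V * Y)" using PVY V0 Y0 by (simp add: field_simps)
    have D0: "D (\<rho> * r) b u \<noteq> 0" using D \<gamma>0 t0 V0 Y0 by simp
    have "P (\<rho> * r) b u * cj (P (\<rho> * r) b u) / (D (\<rho> * r) b u)\<^sup>2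
        = p * cj p / (t' * t' * t\<^sup>2 * \<gamma>\<^sup>2)"
      unfolding D P using V0 Y0 t0 by (simp add: cjV cjY field_simps power2_eq_square)
    also have "t' * t' * t\<^sup>2 = (t * t')\<^sup>2" by (simp add: power2_eq_square)
    finally have PD: "P (\<rho> * r) b u * cj (P (\<rho> * r) b u) / (D (\<rho> * r) b u)\<^sup>2 = p * cj p / \<gamma>\<^sup>2"
      by (simp add: tt)
    have "p * cj p = c2 * t\<^sup>2 + cj c2 * t'\<^sup>2 +
        (p2 * cj p1 * t * (t * t') + p1 * cj p0 * t + (cj p2 * p1 * t' * (t * t') + cj p1 * p0 * t')) +
        (p0 * cj p0 + p1 * cj p1 * (t * t') + p2 * cj p2 * (t * t')\<^sup>2)"
      by (simp add: p_def c2_def cjt) (simp add: char2_simps)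
    also have "\<dots> = (h * t)\<^sup>2 + (cj h * t')\<^sup>2 + (c1 * t + cj c1 * t') + c0"
      unfolding tt by (simp add: c0_def c1_def power_mult_distrib algebra_simps flip: h)
    finally have "p * cj p / \<gamma>\<^sup>2 + 1 =
        (h * t / \<gamma> + cj h * t' / \<gamma>)\<^sup>2 + ((c1 * t + cj c1 * t') / \<gamma>\<^sup>2 + (c0 / \<gamma>\<^sup>2 + 1))"
      by (simp add: square_add power_divide add_divide_distrib add_ac)
    moreover have "h * t / \<gamma> + cj h * t' / \<gamma> \<in> K"
      by (simp add: K_def cjt cj\<gamma> add.commute)
    ultimately have "tr (p * cj p / \<gamma>\<^sup>2 + 1) =
        tr ((h * t / \<gamma> + cj h * t' / \<gamma>) + ((c1 * t + cj c1 * t') / \<gamma>\<^sup>2 + (c0 / \<gamma>\<^sup>2 + 1)))"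
      by (simp only: tr_add tr_square)
    also have "(h * t / \<gamma> + cj h * t' / \<gamma>) + ((c1 * t + cj c1 * t') / \<gamma>\<^sup>2 + (c0 / \<gamma>\<^sup>2 + 1))
        = \<kappa> * t + cj \<kappa> * cj t + (c0 / \<gamma>\<^sup>2 + 1)"
      by (simp add: \<kappa>_def cjt cj\<gamma> distrib_right add_divide_distrib add_ac)
    finally show "tr (\<kappa> * t + cj \<kappa> * cj t + (c0 / \<gamma>\<^sup>2 + 1)) = 0"
      using crit[OF uU] D0 by (simp add: crit_def PD)
  qed
  then have "h * \<gamma> = c1" using \<gamma>0 by (simp add: \<kappa>_def add_eq_0 field_simps power2_eq_square)
  then have "c1\<^sup>2 = (h * \<gamma>)\<^sup>2" by simp
  then have "c1\<^sup>2 = c2 * \<gamma>\<^sup>2" by (simp only: power_mult_distrib h)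
  moreover have "c1 = \<rho> * \<delta> * (b * r' * \<delta> + r' ^ 3 + r)"
    by (simp add: c1_def p0_def p1_def p2_def cjr cjK cj\<delta>) (simp add: \<delta>_def char2_simps)
  moreover have "c2 = p2 * (\<rho> * r'\<^sup>2 + b * r'\<^sup>2 + 1)"
    by (simp add: c2_def p0_def cjr cjK)
  ultimately have "(\<rho> * \<delta>)\<^sup>2 * (b * r' * \<delta> + r' ^ 3 + r)\<^sup>2 =
      (\<rho> * \<delta>)\<^sup>2 * (b\<^sup>2 * \<delta>\<^sup>2 * (p2 * (\<rho> * r'\<^sup>2 + b * r'\<^sup>2 + 1)))"
    by (simp add: \<gamma>_def power_mult_distrib power2_eq_square mult_ac)
  then have "(b * r' * \<delta> + r' ^ 3 + r)\<^sup>2 = b\<^sup>2 * \<delta>\<^sup>2 * (p2 * (\<rho> * r'\<^sup>2 + b * r'\<^sup>2 + 1))"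
    using \<rho>(2) \<delta>0 by simp
  then show ?thesis by (simp only: p2_def \<delta>_def r'_def)
qed

text \<open>
  If \<^term>\<open>r \<notin> K\<close>, then \<open>1\<close> and \<open>s = (cj r)\<^sup>2\<close> are linearly independent over \<^term>\<open>K\<close>, and
  comparing coefficients splits the equation into two equations over \<^term>\<open>K\<close> that force
  \<open>b = 1\<close> and then \<open>r + cj r = 0\<close>.
\<close>

lemma coefficient_eq_imp_in_K:
  assumes \<rho>: "\<rho> \<in> K" "\<rho> \<noteq> 0" and b: "b \<in> K" "b \<noteq> 0" and r: "r * cj r \<noteq> 1"
    and eq: "(b * cj r * (1 + r * cj r) + cj r ^ 3 + r)\<^sup>2 =
    b\<^sup>2 * (1 + r * cj r)\<^sup>2 * ((\<rho> * (r * cj r) + b + (cj r)\<^sup>2) * (\<rho> * (cj r)\<^sup>2 + b * (cj r)\<^sup>2 + 1))"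
    and e: "1 + \<rho>\<^sup>2 * (r * cj r) + b\<^sup>2 = b * \<rho> * (1 + r * cj r)"
  shows "r \<in> K"
proof (rule ccontr)
  assume nK: "r \<notin> K"
  define \<nu> where "\<nu> = r * cj r"
  define \<delta> where "\<delta> = 1 + \<nu>"
  define T where "T = r + cj r"
  define s where "s = (cj r)\<^sup>2"
  define V where "V = \<rho> * \<nu> + b"
  define Z where "Z = \<rho> + b"
  have \<delta>0: "\<delta> \<noteq> 0" using r by (auto simp: \<delta>_def \<nu>_def add_eq_0)
  have T0: "T \<noteq> 0" using nK by (auto simp: T_def K_def add_eq_0)
  have \<nu>K: "\<nu> \<in> K" by (simp add: \<nu>_def K_def mult.commute)
  have TK: "T \<in> K" by (simp add: T_def K_def add.commute)
  have \<delta>K: "\<delta> \<in> K" unfolding \<delta>_def by (intro K_add K_1 \<nu>K)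
  have VK: "V \<in> K" unfolding V_def by (intro K_add K_mult \<rho> b \<nu>K)
  have ZK: "Z \<in> K" unfolding Z_def by (intro K_add K_mult \<rho> b)
  have sK: "s \<notin> K" using nK unfolding s_def by (simp only: square_in_K) (simp add: K_def)
  have e': "1 + \<rho>\<^sup>2 * \<nu> + b\<^sup>2 + b * \<rho> * \<delta> = 0"
    using e by (simp add: \<nu>_def \<delta>_def add_eq_0)
  have VZ: "V * Z = 1"
  proof -
    have "V * Z = 1 + (1 + \<rho>\<^sup>2 * \<nu> + b\<^sup>2 + b * \<rho> * \<delta>)"
      by (simp add: V_def Z_def \<delta>_def char2_simps)
    then show ?thesis using e' by simp
  qed
  \<comment> \<open>\<open>s\<close> has relative trace \<open>T\<^sup>2\<close> and norm
    \<open>\<nu>\<^sup>2\<close> over \<open>K\<close>, so this reduces everything to combinations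
    of \<open>s\<close> and 1.\<close>
  have s2: "s\<^sup>2 = T\<^sup>2 * s + \<nu>\<^sup>2"
    by (simp add: s_def T_def \<nu>_def char2_simps)
  have "((T\<^sup>2)\<^sup>2 + \<delta>\<^sup>2) * s + T\<^sup>2 * \<delta>\<^sup>2 = cj r ^ 6 + r\<^sup>2"
    by (simp add: s_def T_def \<delta>_def \<nu>_def char2_simps)
  also have "\<dots> = (b * cj r * \<delta> + cj r ^ 3 + r)\<^sup>2 + b\<^sup>2 * s * \<delta>\<^sup>2"
    by (simp add: s_def square_add power_mult_distrib add_ac flip: power_mult)
  also have "\<dots> = b\<^sup>2 * \<delta>\<^sup>2 * ((V + s) * (Z * s + 1)) + b\<^sup>2 * s * \<delta>\<^sup>2"
    using eq by (simp add: V_def Z_def s_def \<delta>_def \<nu>_def distrib_right)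
  also have "\<dots> = b\<^sup>2 * \<delta>\<^sup>2 * (V * Z * s + V + Z * s\<^sup>2)"
    by (simp add: char2_simps)
  also have "\<dots> = b\<^sup>2 * \<delta>\<^sup>2 * (1 + Z * T\<^sup>2) * s + b\<^sup>2 * \<delta>\<^sup>2 * (V + Z * \<nu>\<^sup>2)"
    unfolding s2 VZ by (simp add: algebra_simps)
  finally have lin: "((T\<^sup>2)\<^sup>2 + \<delta>\<^sup>2) * s + T\<^sup>2 * \<delta>\<^sup>2 =
      b\<^sup>2 * \<delta>\<^sup>2 * (1 + Z * T\<^sup>2) * s + b\<^sup>2 * \<delta>\<^sup>2 * (V + Z * \<nu>\<^sup>2)" .
  note K_independent_eq[OF sK _ _ _ _ lin]
  then have \<alpha>: "(T\<^sup>2)\<^sup>2 + \<delta>\<^sup>2 = b\<^sup>2 * \<delta>\<^sup>2 * (1 + Z * T\<^sup>2)"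
    and \<beta>: "T\<^sup>2 * \<delta>\<^sup>2 = b\<^sup>2 * \<delta>\<^sup>2 * (V + Z * \<nu>\<^sup>2)"
    using TK \<delta>K VK ZK \<nu>K b(1) by (simp_all add: K_add K_mult K_power K_1)
  have "(T\<^sup>2)\<^sup>2 = \<delta>\<^sup>2 + ((T\<^sup>2)\<^sup>2 + \<delta>\<^sup>2)" by (simp add: add_ac)
  then have \<alpha>: "(T\<^sup>2)\<^sup>2 = \<delta>\<^sup>2 + b\<^sup>2 * \<delta>\<^sup>2 * (1 + Z * T\<^sup>2)" unfolding \<alpha> .
  have "T\<^sup>2 * \<delta>\<^sup>2 = (b\<^sup>2 * \<delta> * (V + b * \<nu>)) * \<delta>\<^sup>2"
    unfolding \<beta> by (simp add: V_def Z_def \<delta>_def char2_simps)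
  then have T: "T\<^sup>2 = b\<^sup>2 * \<delta> * (V + b * \<nu>)" using \<delta>0 by simp
  \<comment> \<open>The two coefficient equations give two values for
    \<open>(T\<^sup>2)\<^sup>2\<close>; equating them leaves a relation linear in
    \<open>T\<^sup>2\<close>.\<close>
  have "\<delta> * (b\<^sup>2 * (V + b * \<nu>) * T\<^sup>2) = T\<^sup>2 * (b\<^sup>2 * \<delta> * (V + b * \<nu>))"
    by (simp add: mult_ac)
  also have "\<dots> = (T\<^sup>2)\<^sup>2"
    unfolding T by (rule power2_eq_square[symmetric])
  also have "\<dots> = \<delta> * (\<delta> * (1 + b\<^sup>2) + \<delta> * b\<^sup>2 * Z * T\<^sup>2)"
    unfolding \<alpha> by (simp add: algebra_simps power2_eq_square)
  finally have *: "b\<^sup>2 * (V + b * \<nu>) * T\<^sup>2 = \<delta> * (1 + b\<^sup>2) + \<delta> * b\<^sup>2 * Z * T\<^sup>2"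
    using \<delta>0 by simp
  have "\<delta> * (1 + b\<^sup>2) = b\<^sup>2 * (V + b * \<nu>) * T\<^sup>2 + \<delta> * b\<^sup>2 * Z * T\<^sup>2"
    by (simp only: * add.assoc add_self add_0_right)
  also have "\<dots> = b\<^sup>2 * T\<^sup>2 * (V + b * \<nu> + \<delta> * Z)"
    by (simp add: algebra_simps)
  also have "V + b * \<nu> + \<delta> * Z = \<rho>"
    by (simp add: V_def Z_def \<delta>_def char2_simps)
  finally have T2: "\<delta> * (1 + b\<^sup>2) = b\<^sup>2 * T\<^sup>2 * \<rho>" .
  also have "\<dots> = \<delta> * (b ^ 4 * (\<rho> * (V + b * \<nu>)))"
    unfolding T by (simp add: eval_nat_numeral mult_ac)
  also have "\<rho> * (V + b * \<nu>) = (1 + b\<^sup>2) + (1 + \<rho>\<^sup>2 * \<nu> + b\<^sup>2 + b * \<rho> * \<delta>)"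
    by (simp add: V_def \<delta>_def char2_simps)
  finally have "1 + b\<^sup>2 = b ^ 4 * (1 + b\<^sup>2)" using e' \<delta>0 by simp
  then have "(1 + b\<^sup>2) + b ^ 4 * (1 + b\<^sup>2) = 0" by (simp only: add_self)
  then have "(b + 1) ^ 6 = 0" by (simp add: char2_simps)
  then have "b = 1" by (simp add: add_eq_0)
  then show False using T2 T0 \<rho>(2) by (simp add: two_eq_0)
qed

text \<open>With \<open>cj r = r\<close>, multiplying by \<open>\<rho>\<^sup>2\<close> leaves only
  \<open>m = (\<rho> * r)\<^sup>2\<close>, \<open>b\<close>, \<open>c\<close> and
  \<open>b * \<rho> * \<delta>\<close>. Replacing the last by \<open>m + c\<close> gives an equation
  that factors.\<close>

lemma coefficient_eq_in_K:
  assumes \<rho>: "\<rho> \<in> K" "\<rho> \<noteq> 0" and b: "b \<in> K" "b \<noteq> 0" and rK: "r \<in> K" and r: "r * cj r \<noteq> 1"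
    and eq: "(b * cj r * (1 + r * cj r) + cj r ^ 3 + r)\<^sup>2 =
    b\<^sup>2 * (1 + r * cj r)\<^sup>2 * ((\<rho> * (r * cj r) + b + (cj r)\<^sup>2) * (\<rho> * (cj r)\<^sup>2 + b * (cj r)\<^sup>2 + 1))"
    and e: "1 + \<rho>\<^sup>2 * (r * cj r) + b\<^sup>2 = b * \<rho> * (1 + r * cj r)"
  shows "b = 1 \<or> (\<rho> * r)\<^sup>2 = b * (b + 1)"
proof -
  define \<delta> where "\<delta> = 1 + r\<^sup>2"
  define m where "m = \<rho>\<^sup>2 * r\<^sup>2"
  define c where "c = (b + 1)\<^sup>2"
  have cjr: "cj r = r" using rK by (rule K_D)
  have \<delta>0: "\<delta> \<noteq> 0" using r by (auto simp: \<delta>_def cjr power2_eq_square add_eq_0)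
  have e': "m + c = b * \<rho> * \<delta>"
    using e by (simp add: m_def c_def \<delta>_def cjr power2_eq_square square_add[unfolded power2_eq_square] add_ac)
  have "\<delta>\<^sup>2 * (r\<^sup>2 * c) = (b * r * \<delta> + r ^ 3 + r)\<^sup>2"
    by (simp add: c_def \<delta>_def char2_simps)
  also have "\<dots> = \<delta>\<^sup>2 * (b\<^sup>2 * ((\<rho> * r\<^sup>2 + b + r\<^sup>2) * (\<rho> * r\<^sup>2 + b * r\<^sup>2 + 1)))"
    using eq by (simp add: \<delta>_def cjr power2_eq_square mult_ac)
  finally have "r\<^sup>2 * c = b\<^sup>2 * ((\<rho> * r\<^sup>2 + b + r\<^sup>2) * (\<rho> * r\<^sup>2 + b * r\<^sup>2 + 1))"
    using \<delta>0 by simp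
  also have "\<dots> = b\<^sup>2 * (\<rho>\<^sup>2 * r ^ 4 + \<rho> * r\<^sup>2 * (b + 1) * \<delta> + r\<^sup>2 * c + b * \<delta>\<^sup>2)"
    by (simp add: c_def \<delta>_def char2_simps)
  finally have rc: "r\<^sup>2 * c = b\<^sup>2 * (\<rho>\<^sup>2 * r ^ 4 + \<rho> * r\<^sup>2 * (b + 1) * \<delta> + r\<^sup>2 * c + b * \<delta>\<^sup>2)" .
  have "m * c = \<rho>\<^sup>2 * (r\<^sup>2 * c)" by (simp add: m_def)
  also have "\<dots> = \<rho>\<^sup>2 * (b\<^sup>2 * (\<rho>\<^sup>2 * r ^ 4 + \<rho> * r\<^sup>2 * (b + 1) * \<delta> + r\<^sup>2 * c + b * \<delta>\<^sup>2))"
    by (simp only: rc [symmetric])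
  also have "\<dots> = b\<^sup>2 * m\<^sup>2 + b * m * (b + 1) * (b * \<rho> * \<delta>) + b\<^sup>2 * m * c + b * (b * \<rho> * \<delta>)\<^sup>2"
    by (simp add: m_def char2_simps)
  also have "\<dots> = b\<^sup>2 * m\<^sup>2 + b * m * (b + 1) * (m + c) + b\<^sup>2 * m * c + b * (m + c)\<^sup>2"
    unfolding e' ..
  finally have "m * c + (b\<^sup>2 * m\<^sup>2 + b * m * (b + 1) * (m + c) + b\<^sup>2 * m * c + b * (m + c)\<^sup>2) = 0"
    by (simp only: add_self)
  then have "c * (m * (b + 1) + b * c) = 0" by (simp add: char2_simps)
  then consider "c = 0" | "m * (b + 1) = b * c" by (auto simp: add_eq_0)
  then show ?thesis
  proof cases
    case 1
    then show ?thesis by (simp add: c_def add_eq_0)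
  next
    case 2
    then have "b + 1 = 0 \<or> m = b * (b + 1)" by (simp add: c_def power2_eq_square)
    then show ?thesis by (auto simp: m_def power_mult_distrib add_eq_0)
  qed
qed

text \<open>On \<open>U\<close>, \<open>u * D a b u\<close> is a quadratic in \<open>u\<close>; its
  root \<open>r\<close> exists in the field because an Artin-Schreier equation over \<open>K\<close>
  is solvable. The cases \<open>r \<in> U\<close> and \<open>r \<notin> U\<close> have been prepared
  above.\<close>

lemma crit_imp:
  assumes b: "b \<in> K" "b \<noteq> 0" and a0: "a \<noteq> 0" and crit: "\<And>u. u \<in> U \<Longrightarrow> crit a b u"
  shows "b = 1 \<and> a \<in> K \<or> a\<^sup>2 = b * (b + 1)"
proof -
  define e where "e = 1 + a * cj a + b\<^sup>2"
  have e0: "e \<noteq> 0" unfolding e_def using assms by (rule crit_imp_nondegenerate)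
  have cjb: "cj b = b" using b(1) by (rule K_D)
  have eK: "cj e = e" using b(1) by (simp add: e_def K_D mult.commute)
  have "b\<^sup>2 * (a * cj a) / e\<^sup>2 \<in> K" by (simp add: K_def cjb eK mult.commute)
  then obtain y where y: "y\<^sup>2 + y = b\<^sup>2 * (a * cj a) / e\<^sup>2" by (rule artin_schreier_solvable)
  define r where "r = e * y / (b * cj a)"
  have "b * cj a * r\<^sup>2 + e * r + b * a = e\<^sup>2 * (y\<^sup>2 + y) / (b * cj a) + b * a"
    using b(2) a0 by (simp add: r_def field_simps power2_eq_square)
  also have "\<dots> = 0" unfolding y using b(2) a0 e0 by (simp add: power2_eq_square)
  finally have root: "b * cj a * r\<^sup>2 + e * r + b * a = 0" .
  then have r0: "r \<noteq> 0" using b(2) a0 by auto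
  show ?thesis
  proof (cases "r \<in> U")
    case True
    have "D a b r = (b * cj a * r\<^sup>2 + e * r + b * a) / r"
      using True r0 by (simp add: D_def e_def U_cj field_simps power2_eq_square)
    then have "D a b r = 0" using root by simp
    then show ?thesis
      using crit_imp_if_root_in_U[OF b a0 _ crit True] e0 by (simp add: e_def)
  next
    case False
    then have rr: "r * cj r \<noteq> 1" by (simp add: U_def)
    then have \<delta>0: "r * cj r + 1 \<noteq> 0" by (simp add: add_eq_0)
    have root': "b * a * (cj r)\<^sup>2 + e * cj r + b * cj a = 0"
      using arg_cong[OF root, of cj] by (simp add: cjb eK)
    \<comment> \<open>Combining the root equation with its conjugate eliminates \<open>e\<close>; as
      \<open>r * cj r + 1\<close> is nonzero off \<open>U\<close>, this puts \<open>a / r\<close> in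
      \<open>K\<close>.\<close>
    have "b * (r * cj r + 1) * (cj a * r + a * cj r) =
        cj r * (b * cj a * r\<^sup>2 + e * r + b * a) + r * (b * a * (cj r)\<^sup>2 + e * cj r + b * cj a)"
      by (simp add: char2_simps)
    also have "\<dots> = 0" by (simp add: root root')
    finally have ar: "cj a * r = a * cj r" using b(2) \<delta>0 by (simp add: add_eq_0)
    define \<rho> where "\<rho> = a / r"
    have a: "a = \<rho> * r" using r0 by (simp add: \<rho>_def)
    have \<rho>: "\<rho> \<in> K" "\<rho> \<noteq> 0" using ar r0 a0 by (simp_all add: \<rho>_def K_def frac_eq_eq)
    have "r * (b * \<rho> * (1 + r * cj r) + e) = b * cj a * r\<^sup>2 + e * r + b * a"
      using \<rho>(1) by (simp add: a K_D char2_simps)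
    also have "\<dots> = 0" by (rule root)
    finally have "e = b * \<rho> * (1 + r * cj r)" using r0 by (simp add: add_eq_0)
    then have e: "1 + \<rho>\<^sup>2 * (r * cj r) + b\<^sup>2 = b * \<rho> * (1 + r * cj r)"
      using \<rho>(1) by (simp add: e_def a K_D power2_eq_square mult_ac)
    have eq: "(b * cj r * (1 + r * cj r) + cj r ^ 3 + r)\<^sup>2 =
    b\<^sup>2 * (1 + r * cj r)\<^sup>2 * ((\<rho> * (r * cj r) + b + (cj r)\<^sup>2) * (\<rho> * (cj r)\<^sup>2 + b * (cj r)\<^sup>2 + 1))"
      using crit by (intro crit_imp_coefficient_eq[OF \<rho> b rr _ e]) (simp add: a)
    have rK: "r \<in> K" by (rule coefficient_eq_imp_in_K[OF \<rho> b rr eq e])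
    have "a \<in> K" unfolding a using \<rho>(1) rK by (rule K_mult)
    then show ?thesis using coefficient_eq_in_K[OF \<rho> b rK rr eq e] a by auto
  qed
qed

section \<open>The characterization over \<open>K\<close> and its transfer to the given
  subfield\<close>

lemma permutation_iff:
  assumes b: "b \<in> K" "b \<noteq> 0" and a0: "a \<noteq> 0"
  shows "permutation_polynomial (trinomial q a b) \<longleftrightarrow>
    (b = 1 \<and> a \<in> K \<and> tr (1 + inverse a) = 0) \<or>
    (b \<noteq> 1 \<and> tr (b / (b + 1)) = 0 \<and> a\<^sup>2 = b * (b + 1))"
    (is "_ \<longleftrightarrow> ?R")
  unfolding permutation_iff_crit[OF b(1)]
proof
  assume crit: "\<forall>u\<in>U. crit a b u"
  \<comment> \<open>For \<open>b = 1\<close> the alternative \<open>a\<^sup>2 = b * (b + 1)\<close>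
    would give \<open>a = 0\<close>.\<close>
  consider "b = 1" "a \<in> K" | "b \<noteq> 1" "a\<^sup>2 = b * (b + 1)"
    using crit_imp[OF b a0] crit a0 by (cases "b = 1") auto
  then show ?R
  proof cases
    case 1
    have "tr (1 / a\<^sup>2 + 1) = 0"
      using crit_at_1[of a b] crit 1 a0 b by (simp add: add_ac)
    moreover have "1 / a\<^sup>2 + 1 = (1 + inverse a)\<^sup>2"
      unfolding square_add by (simp add: power_inverse divide_inverse add.commute)
    moreover have "1 + inverse a \<in> K" using 1(2) by (simp add: K_def)
    ultimately show ?thesis using 1 by (simp add: tr_square)
  next
    case 2
    have b1: "b + 1 \<noteq> 0" using 2(1) by (simp add: add_eq_0)
    have "a\<^sup>2 \<in> K" unfolding 2(2) using b(1) by (intro K_mult K_add K_1)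
    then have aK: "a \<in> K" by (simp only: square_in_K)
    have e: "1 + a\<^sup>2 + b\<^sup>2 = b + 1" unfolding 2(2) by (simp add: char2_simps)
    have "tr (1 / (b + 1) + 1) = 0"
      using crit_at_1[OF _ b(1) aK] crit b1 by (simp add: e)
    moreover have "1 / (b + 1) + 1 = b / (b + 1)" using b1 by (simp add: field_simps)
    ultimately show ?thesis using 2 by simp
  qed
next
  assume ?R
  then show "\<forall>u\<in>U. crit a b u"
    using crit_if_b_1 crit_if_square_eq b a0 by auto
qed

end

theorem theorem1p1:
  fixes a b :: "'a :: finite_field" and Fq :: "'a set" and q n :: nat
  assumes "n \<ge> 1" and "q = 2 ^ n"
    and "CARD('a) = q ^ 2"
    and "subfield Fq (ring_of_type_algebra :: 'a ring)" and "card Fq = q"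
    and "a \<noteq> 0"
    and "b \<in> Fq" and "b \<noteq> 0"
  shows "permutation_polynomial (trinomial q a b) \<longleftrightarrow>
           (b = 1 \<and> a \<in> Fq \<and> a \<noteq> 0 \<and> absolute_trace n (1 + inverse a) = 0) \<or>
           (b \<noteq> 1 \<and> absolute_trace n (b / (b + 1)) = 0 \<and> a ^ 2 = b * (b + 1))"
proof -
  interpret char2_quadratic_ext "TYPE('a)" n q
    using assms(1-3) by unfold_locales
  have "Fq = K" using assms(4,5) by (rule subfield_eq_K)
  then show ?thesis
    using permutation_iff[of b a] assms(6-8) by (simp add: tr_def)
qed

end
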